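(* Let $m=k/2$ ($k\in\mathbb N$), $m>1$, $m'=m-\frac12$, $\rho\ge0$, $N\ge1$, let $f_m\in\Gamma_0^m$ be a real valued classical symbol of order $m$, even in $\xi$, let $\omega_j:=f_m(j)$, $\Omega e^{\mathrm ijx}=\omega_je^{\mathrm ijx}$. Consider the system in Poincar\'e--Birkhoff normal form $$\dot W=\mathcal Y_N(W)=\mathrm iE\Omega W+\mathrm iE\,\mathrm{Op}^{BW}\big([\![\mathfrak M^{(N)}]\!](W;\xi)\big)[W]+[\![\mathcal Q_N]\!](W)[W],\qquad (\mathrm{N})$$ where $\mathcal Y_N$ is a Hamiltonian vector field, $\mathcal Q_N\in\Sigma\mathcal R^{-\rho}_2[r,N]\otimes\mathcal M_2(\mathbb C)$ is real-to-real, $\mathfrak M^{(N)}(W;\xi)=\mathrm{diag}(\mathfrak m^{(N)}(W;\xi),\mathfrak m^{(N)}(W;-\xi))\in\Sigma\Gamma^m_2[r,N]\otimes\mathcal M_2(\mathbb C)$ is independent of $x$, with $\mathfrak m^{(N)}=\mathfrak m^{(1)}_m(W)f_m(\xi)+\mathfrak m^{(N)}_{m'}(W;\xi)$ real valued, $\mathfrak m_m^{(1)}\in\Sigma\mathcal F^{\mathbb R}_1[r,N]$, $\mathfrak m^{(N)}_{m'}\in\Sigma\Gamma^{m'}_1[r,N]$. Let $T>0$ and let $W=(w,\bar w)\in C^0([0,T);H^s(\mathbb T;\mathbb C^2))\cap C^1([0,T);H^{s-m}(\mathbb T;\mathbb C^2))$ be a solution of (N) with initial condition $W_0=(w_0,\overline{w_0})\in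 B_r(H^s(\mathbb T;\mathbb C^2))$, $0<r\ll1$. Then there exists $C=C(s)>0$ such that $$\|w(t)\|_{H^s}^2\le\|w_0\|_{H^s}^2+C\int_0^t\|w(\sigma)\|_{H^s}^{N+2}\,d\sigma,\qquad\forall\,t\in[0,T).$$
   Context: **Resonant parts.** Write $u_n^+=u_n=\hat u(n)$, $u_n^-=\overline{u_n}$. For $q$ even, $\mathcal S_q$ is the set of $(\vec\sigma,\vec j)\in\{\pm\}^q\times\mathbb Z^q$ such that, up to a permutation of the indices, $\sigma_i=-\sigma_{q/2+i}$ and $|j_i|=|j_{q/2+i}|$ for $i=1,\dots,q/2$; $\mathcal S_q=\emptyset$ for $q$ odd. An $x$-independent $a_p\in\widetilde\Gamma^{m}_p$ has the form $a_p(U;\xi)=\sum_{\sum\sigma_ij_i=0}(a_p)^{\sigma_1\cdots\sigma_p}_{j_1,\dots,j_p}(\xi)u^{\sigma_1}_{j_1}\cdots u^{\sigma_p}_{j_p}$; $[\![a_p]\!]$ is the same sum restricted to $(\vec\sigma,\vec j)\in\mathcal S_p$. For $a=\sum_{p=1}^{N-1}a_p+a_N$, $[\![a]\!]=\sum_{p=1}^{N-1}[\![a_p]\!]+a_N$; for $A=\mathrm{diag}(a(U;\xi),\overline{a(U;-\xi)})$, $[\![A]\!]=\mathrm{diag}([\![a]\!](U;\xi),[\![\overline a]\!](U;-\xi))$. A matrix $R_p\in\widetilde{\mathcal R}^{-\rho}_p\otimes\mathcal M_2(\mathbb C)$ has entries $(R_p(U))_\sigma^{\sigma'}$, with $(R_p(U))_\sigma^{\sigma'}z^{\sigma'}=\frac1{\sqrt{2\pi}}\sum_j\big(\sum_k(R_p(U))_{\sigma,j}^{\sigma',k}z_k^{\sigma'}\big)e^{\mathrm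 i\sigma jx}$ and $(R_p(U))_{\sigma,j}^{\sigma',k}=(2\pi)^{-p}\sum_{\sum_i\sigma_ij_i=\sigma j-\sigma'k}\big((r_p)^{\sigma_1\cdots\sigma_p}_{j_1,\dots,j_p}\big)_{\sigma,j}^{\sigma',k}u^{\sigma_1}_{j_1}\cdots u^{\sigma_p}_{j_p}$; $[\![R_p]\!]$ is obtained restricting the last sum to $\big((\sigma_1,\dots,\sigma_p,-\sigma,\sigma'),(j_1,\dots,j_p,j,k)\big)\in\mathcal S_{p+2}$. For $R=\sum_{p=1}^{N-1}R_p+R_N$, $[\![R]\!]=\sum_{p=1}^{N-1}[\![R_p]\!]+R_N$. **Hamiltonian structure.** $E=\mathrm{diag}(1,-1)$, $J=\begin{pmatrix}0&1\\-1&0\end{pmatrix}$; Hamiltonian vector fields are $X_H=\mathrm iJ\nabla H=(\mathrm i\partial_{\bar u}H,-\mathrm i\partial_uH)^T$ with $H$ real valued, on couples $U=(u,\bar u)$. A matrix of operators is real-to-real if it has the form $\begin{pmatrix}R_1&R_2\\ \overline{R_2}&\overline{R_1}\end{pmatrix}$, with $\overline R(U)[V]:=\overline{R(U)[\overline V]}$. **Spaces.** $\mathbb T=\mathbb R/2\pi\mathbb Z$, $u(x)=\sum_n\hat u(n)e^{\mathrm inx}/\sqrt{2\pi}$, $\langle j\rangle=\sqrt{1+j^2}$, $\|u\|_{H^s}^2=\sum_j\langle j\rangle^{2s}|\hat u(j)|^2$ (also written $\|u\|_s$), $B_r(H^s)$ the ball of radius $r$. $\Pi_n$ ($n\ge1$)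 is the $L^2$ projector on $\mathrm{span}\{e^{\mathrm inx},e^{-\mathrm inx}\}$, $\Pi_0$ that on constants; $\Pi_{\vec n}(U_1,\dots,U_p)=(\Pi_{n_1}U_1,\dots,\Pi_{n_p}U_p)$; $\tau_\theta u(x)=u(x+\theta)$. Here $s\ge s_0$ with $s_0$ large enough. **Symbols.** Let $d=m$. For $\mu'\in\mathbb R$, $p\ge1$, $\widetilde\Gamma^{\mu'}_p$ is the space of symmetric $p$-linear maps $\mathcal V=(U_1,\dots,U_p)\in H^\infty(\mathbb T;\mathbb C^2)^p\mapsto a(\mathcal V;x,\xi)\in C^\infty(\mathbb T\times\mathbb R)$ such that: for some $\mu>0$ and all $\alpha,\beta\in\mathbb N$ there is $C$ with $|\partial_x^\alpha\partial_\xi^\beta a(\Pi_{\vec n}\mathcal V;x,\xi)|\le C|\vec n|^{\mu+\alpha}\langle\xi\rangle^{\mu'-\beta}\prod_j\|\Pi_{n_j}U_j\|_{L^2}$ for $\vec n\in(\mathbb N^* )^p$; if $\Pi_{n_0}a(\Pi_{n_1}U_1,\dots,\Pi_{n_p}U_p;\cdot)\ne0$ then $\sum_{j=0}^p\sigma_jn_j=0$ for some signs $\sigma_j$; and $a(\tau_\theta\mathcal V;x,\xi)=a(\mathcal V;x+\theta,\xi)$. $\widetilde\Gamma^{\mu'}_0=\Gamma^{\mu'}_0$ is the space of $a(\xi)$ with $|\partial_\xi^\beta a|\le C_\beta\langle\xi\rangle^{\mu'-\beta}$. One writes $a(U;x,\xi)=a(U,\dots,U;x,\xi)$. For $p\ge1$,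 $\Gamma^{\mu'}_p[r]$ is the space of functions $a(U;x,\xi)$ defined for $U\in B_r(H^{s_0})$, $s_0$ large, such that for any $s\ge s_0$ there are $C>0$, $0<r_0<r$ such that for $U\in B_{r_0}(H^{s_0})\cap H^s$, $\alpha+dk\le s-s_0$, $h_j\in H^s$, $$|\partial_x^\alpha\partial_\xi^\beta(d_U^ka(U;x,\xi)[h_1,\dots,h_k])|\le C\langle\xi\rangle^{\mu'-\beta}\Big[\max\{0,p-k\}\|U\|_{s_0}^{\max\{0,p-k-1\}}\|U\|_{s_0+\alpha}\prod_j\|h_j\|_{s_0}+\|U\|_{s_0}^{\max\{0,p-k\}}\sum_i\prod_{j\ne i}\|h_j\|_{s_0}^\nu\|h_i\|_{s_0+\alpha}\Big],$$ $\nu=1$ if $k\ge2$, $\nu=0$ otherwise. $\Sigma\Gamma^{\mu'}_p[r,N]$: sums $\sum_{q=p}^{N-1}a_q+a_N$ with $a_q\in\widetilde\Gamma^{\mu'}_q$, $a_N\in\Gamma^{\mu'}_N[r]$. $\Sigma\mathcal F_p[r,N]$: elements of $\Sigma\Gamma^0_p[r,N]$ independent of $\xi$; superscript $\mathbb R$ means real valued. $\otimes\mathcal M_2(\mathbb C)$ denotes $2\times2$ matrices. A symbol of order $m$ is classical if $a\sim\sum_{j\ge0}a_j$ with $a_j$ positively homogeneous in $\xi$ of degree $m-j$. **Quantization.** Let $\chi(\xi',\xi)$, $\chi_p(\xi',\xi)$ ($\xi'\in\mathbb R$, resp. $\mathbb R^p$) be $C^\infty$, even in each argument, supported in $|\xi'|\le\delta\langle\xi\rangle$,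 equal to $1$ for $|\xi'|\le\frac\delta2\langle\xi\rangle$ ($\delta>0$ small), with $|\partial_\xi^\alpha\partial_{\xi'}^\beta\chi|\le C\langle\xi\rangle^{-\alpha-|\beta|}$, same for $\chi_p$. For $a\in\widetilde\Gamma^{\mu'}_p$ put $a_\chi=\sum_{\vec n}\chi_p(\vec n,\xi)a(\Pi_{\vec n}\mathcal V;x,\xi)$; for $a\in\Gamma^{\mu'}_p[r]$ let $a_\chi$ have $x$-Fourier coefficients $\chi(\eta,\xi)\hat a(U;\eta,\xi)$. Then $\mathrm{Op}^{BW}(a)v=\frac1{\sqrt{2\pi}}\sum_k\big(\sum_j\hat a_\chi(k-j,\frac{k+j}2)\hat v(j)\big)\frac{e^{\mathrm ikx}}{\sqrt{2\pi}}$, extended to $\Sigma\Gamma$ by linearity and to matrices entrywise. **Smoothing operators.** $\widetilde{\mathcal R}^{-\rho}_p$: $(p+1)$-linear maps $(U_1,\dots,U_{p+1})\mapsto R(U_1,\dots,U_p)U_{p+1}$ from $C^\infty(\mathbb T;\mathbb C^2)^p\times C^\infty(\mathbb T;\mathbb C)$ to $C^\infty(\mathbb T;\mathbb C)$, symmetric in $U_1,\dots,U_p$, such that for some $\mu\ge0$, $C>0$, $\|\Pi_{n_0}R(\Pi_{\vec n}\mathcal V)\Pi_{n_{p+1}}U_{p+1}\|_{L^2}\le C\frac{\max_2(\langle n_1\rangle,\dots,\langle n_{p+1}\rangle)^{\rho+\mu}}{\max(\langle n_1\rangle,\dots,\langle n_{p+1}\rangle)^\rho}\prod_{j=1}^{p+1}\|\Pi_{n_j}U_j\|_{L^2}$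 ($\max_2$ = second largest); if the left side is nonzero then $\sum_{j=0}^{p+1}\sigma_jn_j=0$ for some signs; and $R(\tau_\theta\mathcal V)[\tau_\theta U_{p+1}]=\tau_\theta(R(\mathcal V)U_{p+1})$. $\mathcal R^{-\rho}_p[r]$: maps $(V,u)\mapsto R(V)u$ on $B_r(H^{s_0})\times H^{s_0}$, linear in $u$, such that for any $s\ge s_0$ there are $C>0$, $r(s)\in(0,r)$ such that for $V\in B_{r(s)}(H^{s_0})\cap H^s$, $0\le dk\le s-s_0$, $$\|(d_V^kR(V)u)[h_1,\dots,h_k]\|_{H^{s+\rho-dk}}\le C\Big[\max\{0,p-k\}\|V\|_{s_0}^{\max\{0,p-k-1\}}\|V\|_s\|u\|_{s_0}\prod_j\|h_j\|_{s_0}+\|V\|_{s_0}^{\max\{0,p-k\}}\|u\|_{s_0}\sum_i\prod_{j\ne i}\|h_j\|^\nu_{s_0}\|h_i\|_s+\|V\|_{s_0}^{\max\{0,p-k\}}\|u\|_s\prod_j\|h_j\|_{s_0}\Big].$$ $\Sigma\mathcal R^{-\rho}_p[r,N]$: sums $\sum_{q=p}^{N-1}R_q+R_N$ with $R_q\in\widetilde{\mathcal R}^{-\rho}_q$, $R_N\in\mathcal R^{-\rho}_N[r]$. *)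

theory Defs
  imports "HOL-Analysis.Analysis" "HOL-Library.Function_Algebras" "HOL-Combinatorics.Permutations"
begin

section \<open>Functions on the circle and Sobolev spaces\<close>

text \<open>
  A function \<open>u\<close> on the circle is represented by its Fourier coefficients with respect to the
  orthonormal basis \<open>e\<^sup>i\<^sup>n\<^sup>x / sqrt (2 pi)\<close>, so that \<open>u n\<close> is the \<open>n\<close>-th coefficient.
  A \<open>\<complex>\<^sup>2\<close>-valued function \<open>U = (U\<^sup>+, U\<^sup>-)\<close> is a map from signs to such functions.
  Addition and subtraction are pointwise.
\<close>

datatype sign = Pl | Mi

fun sg :: "sign \<Rightarrow> int" where
  "sg Pl = 1"
| "sg Mi = -1"

fun opp :: "sign \<Rightarrow> sign" where
  "opp Pl = Mi"
| "opp Mi = Pl"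

type_synonym fn = "int \<Rightarrow> complex"
type_synonym vec = "sign \<Rightarrow> fn"

definition jap :: "real \<Rightarrow> real" where
  "jap y = sqrt (1 + y\<^sup>2)"

definition sob :: "real \<Rightarrow> fn \<Rightarrow> bool" where
  "sob s u \<longleftrightarrow> (\<lambda>n. jap (of_int n) powr (2 * s) * (cmod (u n))\<^sup>2) summable_on UNIV"

definition sob_norm :: "real \<Rightarrow> fn \<Rightarrow> real" where
  "sob_norm s u = sqrt (\<Sum>\<^sub>\<infinity>n. jap (of_int n) powr (2 * s) * (cmod (u n))\<^sup>2)"

definition vsob :: "real \<Rightarrow> vec \<Rightarrow> bool" where
  "vsob s U \<longleftrightarrow> (\<forall>\<sigma>. sob s (U \<sigma>))"

definition vsob_norm :: "real \<Rightarrow> vec \<Rightarrow> real" where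
  "vsob_norm s U = sqrt ((sob_norm s (U Pl))\<^sup>2 + (sob_norm s (U Mi))\<^sup>2)"

definition sball :: "real \<Rightarrow> real \<Rightarrow> vec set" where
  "sball s r = {U. vsob s U \<and> vsob_norm s U < r}"

definition smooth_fns :: "fn set" where
  "smooth_fns = {u. \<forall>s. sob s u}"

definition smooth_vecs :: "vec set" where
  "smooth_vecs = {U. \<forall>s. vsob s U}"

definition fconj :: "fn \<Rightarrow> fn" where
  "fconj u = (\<lambda>n. cnj (u (- n)))"

definition couple :: "fn \<Rightarrow> vec" where
  "couple u = (\<lambda>\<sigma>. case \<sigma> of Pl \<Rightarrow> u | Mi \<Rightarrow> fconj u)"

text \<open>The involution \<open>(U\<^sup>+, U\<^sup>-) \<mapsto> (conj U\<^sup>-, conj U\<^sup>+)\<close>, whose fixed points are the couples \<open>(u, conj u)\<close>.\<close>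

definition vconj :: "vec \<Rightarrow> vec" where
  "vconj U = (\<lambda>\<sigma>. fconj (U (opp \<sigma>)))"

definition proj :: "nat \<Rightarrow> fn \<Rightarrow> fn" where
  "proj n u = (\<lambda>k. if nat \<bar>k\<bar> = n then u k else 0)"

definition vproj :: "nat \<Rightarrow> vec \<Rightarrow> vec" where
  "vproj n U = (\<lambda>\<sigma>. proj n (U \<sigma>))"

definition vprojs :: "nat list \<Rightarrow> vec list \<Rightarrow> vec list" where
  "vprojs ns Us = map2 vproj ns Us"

definition shift :: "real \<Rightarrow> fn \<Rightarrow> fn" where
  "shift \<theta> u = (\<lambda>n. exp (\<i> * of_int n * of_real \<theta>) * u n)"

definition vshift :: "real \<Rightarrow> vec \<Rightarrow> vec" where
  "vshift \<theta> U = (\<lambda>\<sigma>. shift \<theta> (U \<sigma>))"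

text \<open>
  The coefficients \<open>u\<^sup>\<sigma>\<^sub>j\<close>: the component \<open>U\<^sup>\<sigma>\<close> is expanded along \<open>e\<^sup>i\<^sup>\<sigma>\<^sup>j\<^sup>x\<close>, so on a
  couple \<open>(u, conj u)\<close> one gets \<open>u\<^sup>+\<^sub>j = u j\<close> and \<open>u\<^sup>-\<^sub>j = cnj (u j)\<close>.
\<close>

definition coef :: "sign \<Rightarrow> int \<Rightarrow> vec \<Rightarrow> complex" where
  "coef \<sigma> j U = U \<sigma> (sg \<sigma> * j)"

definition fbasis :: "int \<Rightarrow> fn" where
  "fbasis k = (\<lambda>n. if n = k then 1 else 0)"

definition vbasis :: "sign \<Rightarrow> int \<Rightarrow> vec" where
  "vbasis \<sigma> j = (\<lambda>\<sigma>'. if \<sigma>' = \<sigma> then fbasis (sg \<sigma> * j) else 0)"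

text \<open>Multilinearity over the scalars \<open>F\<close> of a functional of \<open>p\<close> arguments from \<open>S\<close>.\<close>

definition multilinear_on :: "complex set \<Rightarrow> vec set \<Rightarrow> nat \<Rightarrow> (vec list \<Rightarrow> complex) \<Rightarrow> bool" where
  "multilinear_on F S p f \<longleftrightarrow>
     (\<forall>Us V c i. length Us = p \<and> set Us \<subseteq> S \<and> V \<in> S \<and> c \<in> F \<and> i < p \<longrightarrow>
        f (Us[i := (\<lambda>\<sigma> n. c * V \<sigma> n) + Us ! i]) = c * f (Us[i := V]) + f Us)"

definition linear_fn_on :: "fn set \<Rightarrow> (fn \<Rightarrow> fn) \<Rightarrow> bool" where
  "linear_fn_on S f \<longleftrightarrow>
     (\<forall>u\<in>S. \<forall>v\<in>S. \<forall>c. f ((\<lambda>n. c * v n) + u) = (\<lambda>n. c * f v n) + f u)"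

definition symmetric_on :: "vec set \<Rightarrow> nat \<Rightarrow> (vec list \<Rightarrow> 'b) \<Rightarrow> bool" where
  "symmetric_on S p f \<longleftrightarrow>
     (\<forall>Us Vs. length Us = p \<and> set Us \<subseteq> S \<and> mset Us = mset Vs \<longrightarrow> f Us = f Vs)"

text \<open>\<open>\<Sum>\<^sub>j \<sigma>\<^sub>j n\<^sub>j = 0\<close> for some choice of signs.\<close>

definition signed_zero :: "nat list \<Rightarrow> bool" where
  "signed_zero ns \<longleftrightarrow>
     (\<exists>\<sigma>s. length \<sigma>s = length ns \<and> (\<Sum>i<length ns. sg (\<sigma>s ! i) * int (ns ! i)) = 0)"

text \<open>
  \<open>frechet_tower s A B K F D\<close>: the maps \<open>D k U [h\<^sub>1, \<dots>, h\<^sub>k]\<close> are the iterated (real) Frechet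
  differentials of \<open>F\<close> on the subset \<open>A\<close> of \<open>H\<^sup>s\<close>, for all orders \<open>k\<close> with \<open>K k\<close>; the \<open>k\<close>-th one is
  taken in the normed space described by \<open>B k z e\<close> (``\<open>z\<close> lies in the space and its norm is at most \<open>e\<close>'').
\<close>

definition frechet_tower ::
  "real \<Rightarrow> vec set \<Rightarrow> (nat \<Rightarrow> 'b::minus \<Rightarrow> real \<Rightarrow> bool) \<Rightarrow> (nat \<Rightarrow> bool) \<Rightarrow>
     (vec \<Rightarrow> 'b) \<Rightarrow> (nat \<Rightarrow> vec \<Rightarrow> vec list \<Rightarrow> 'b) \<Rightarrow> bool" where
  "frechet_tower s A B K F D \<longleftrightarrow>
     (\<forall>U\<in>A. D 0 U [] = F U) \<and>
     (\<forall>k. K (Suc k) \<longrightarrow> (\<forall>U\<in>A. \<forall>\<epsilon>>0. \<exists>\<delta>>0. \<forall>h hs.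
        vsob s h \<and> vsob_norm s h < \<delta> \<and> U + h \<in> A \<and> length hs = k \<and> (\<forall>g\<in>set hs. vsob s g) \<longrightarrow>
          B (Suc k) (D k (U + h) hs - D k U hs - D (Suc k) U (h # hs))
            (\<epsilon> * vsob_norm s h * (\<Prod>g\<leftarrow>hs. vsob_norm s g))))"

section \<open>Symbols\<close>

text \<open>A symbol value is a function of \<open>x\<close> and \<open>\<xi>\<close>.\<close>

type_synonym xsym = "real \<Rightarrow> real \<Rightarrow> complex"

definition vd :: "(real \<Rightarrow> complex) \<Rightarrow> real \<Rightarrow> complex" where
  "vd f = (\<lambda>y. vector_derivative f (at y))"

definition ddx :: "xsym \<Rightarrow> xsym" where
  "ddx a = (\<lambda>x \<xi>. vd (\<lambda>y. a y \<xi>) x)"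

definition ddxi :: "xsym \<Rightarrow> xsym" where
  "ddxi a = (\<lambda>x. vd (a x))"

definition pd :: "nat \<Rightarrow> nat \<Rightarrow> xsym \<Rightarrow> xsym" where
  "pd \<alpha> \<beta> a = (ddx ^^ \<alpha>) ((ddxi ^^ \<beta>) a)"

text \<open>The derivatives \<open>pd \<alpha> \<beta> a\<close> exist for all \<open>\<beta>\<close> and all \<open>\<alpha> \<le> A\<close>.\<close>

definition has_pds :: "nat \<Rightarrow> xsym \<Rightarrow> bool" where
  "has_pds A a \<longleftrightarrow>
     (\<forall>\<beta> x \<xi>. (ddxi ^^ \<beta>) a x differentiable (at \<xi>)) \<and>
     (\<forall>\<alpha><A. \<forall>\<beta> x \<xi>. (\<lambda>y. pd \<alpha> \<beta> a y \<xi>) differentiable (at x))"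

definition smooth_xsym :: "xsym \<Rightarrow> bool" where
  "smooth_xsym a \<longleftrightarrow>
     (\<forall>x \<xi>. a (x + 2 * pi) \<xi> = a x \<xi>) \<and> (\<forall>A. has_pds A a) \<and>
     (\<forall>\<alpha> \<beta>. continuous_on UNIV (\<lambda>(x, \<xi>). pd \<alpha> \<beta> a x \<xi>))"

definition fourier :: "(real \<Rightarrow> complex) \<Rightarrow> int \<Rightarrow> complex" where
  "fourier f n = integral {0..2 * pi} (\<lambda>x. f x * exp (- \<i> * of_int n * of_real x)) / of_real (sqrt (2 * pi))"

definition sym0 :: "real \<Rightarrow> (real \<Rightarrow> complex) \<Rightarrow> bool" where
  "sym0 \<mu>' a \<longleftrightarrow>
     (\<forall>\<beta> \<xi>. (vd ^^ \<beta>) a differentiable (at \<xi>)) \<and>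
     (\<forall>\<beta>. \<exists>C. \<forall>\<xi>. cmod ((vd ^^ \<beta>) a \<xi>) \<le> C * jap \<xi> powr (\<mu>' - real \<beta>))"

text \<open>The expansion \<open>a \<sim> \<Sum>\<^sub>j a\<^sub>j\<close> is for \<open>\<bar>\<xi>\<bar> \<ge> 1\<close>, since the \<open>a\<^sub>j\<close> are in general singular at \<open>0\<close>.\<close>

definition classical_symbol :: "real \<Rightarrow> (real \<Rightarrow> complex) \<Rightarrow> bool" where
  "classical_symbol m a \<longleftrightarrow> sym0 m a \<and>
     (\<exists>aj :: nat \<Rightarrow> real \<Rightarrow> complex.
        (\<forall>j. (\<forall>\<beta> \<xi>. \<xi> \<noteq> 0 \<longrightarrow> (vd ^^ \<beta>) (aj j) differentiable (at \<xi>)) \<and>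
             (\<forall>t \<xi>. t > 0 \<and> \<xi> \<noteq> 0 \<longrightarrow> aj j (t * \<xi>) = of_real (t powr (m - real j)) * aj j \<xi>)) \<and>
        (\<forall>J \<beta>. \<exists>C. \<forall>\<xi>. \<bar>\<xi>\<bar> \<ge> 1 \<longrightarrow>
             cmod ((vd ^^ \<beta>) (\<lambda>\<eta>. a \<eta> - (\<Sum>j<J. aj j \<eta>)) \<xi>) \<le> C * jap \<xi> powr (m - real J - real \<beta>)))"

type_synonym hsym = "vec list \<Rightarrow> xsym"
type_synonym nsym = "vec \<Rightarrow> xsym"

definition nnorm :: "nat list \<Rightarrow> real" where
  "nnorm ns = sqrt (\<Sum>n\<leftarrow>ns. (real n)\<^sup>2)"

definition hom_symbol :: "real \<Rightarrow> nat \<Rightarrow> hsym \<Rightarrow> bool" where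
  "hom_symbol \<mu>' p a \<longleftrightarrow>
     (\<forall>Us. length Us = p \<and> set Us \<subseteq> smooth_vecs \<longrightarrow> smooth_xsym (a Us)) \<and>
     (\<forall>x \<xi>. multilinear_on UNIV smooth_vecs p (\<lambda>Us. a Us x \<xi>)) \<and>
     symmetric_on smooth_vecs p a \<and>
     (\<exists>\<mu>>0. \<forall>\<alpha> \<beta>. \<exists>C. \<forall>ns Us x \<xi>.
        length ns = p \<and> (\<forall>n\<in>set ns. n \<ge> 1) \<and> length Us = p \<and> set Us \<subseteq> smooth_vecs \<longrightarrow>
        cmod (pd \<alpha> \<beta> (a (vprojs ns Us)) x \<xi>)
          \<le> C * nnorm ns powr (\<mu> + real \<alpha>) * jap \<xi> powr (\<mu>' - real \<beta>)
              * (\<Prod>U\<leftarrow>vprojs ns Us. vsob_norm 0 U)) \<and>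
     (\<forall>n0 ns Us \<xi>. length ns = p \<and> length Us = p \<and> set Us \<subseteq> smooth_vecs \<and>
        proj n0 (fourier (\<lambda>x. a (vprojs ns Us) x \<xi>)) \<noteq> 0 \<longrightarrow> signed_zero (n0 # ns)) \<and>
     (\<forall>\<theta> Us x \<xi>. length Us = p \<and> set Us \<subseteq> smooth_vecs \<longrightarrow>
        a (map (vshift \<theta>) Us) x \<xi> = a Us (x + \<theta>) \<xi>)"

text \<open>
  The right-hand side common to the estimates of non-homogeneous symbols and smoothing operators:
  \<open>H\<close> stands for the stronger norm of the factor it is applied to.
\<close>

definition gain :: "nat \<Rightarrow> real \<Rightarrow> (vec \<Rightarrow> real) \<Rightarrow> vec \<Rightarrow> vec list \<Rightarrow> real" where
  "gain p s0 H U hs =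
     (let k = length hs; \<nu> = (if k \<ge> 2 then 1 else 0 :: nat) in
        real (p - k) * vsob_norm s0 U ^ (p - k - 1) * H U * (\<Prod>h\<leftarrow>hs. vsob_norm s0 h)
      + vsob_norm s0 U ^ (p - k) *
          (\<Sum>i<k. (\<Prod>j\<in>{..<k} - {i}. vsob_norm s0 (hs ! j) ^ \<nu>) * H (hs ! i)))"

text \<open>
  Here \<open>d\<close> is the loss of regularity per differential. The functions \<open>D x \<xi> k U hs\<close> are the
  differentials \<open>d\<^sub>U\<^sup>k a(U; x, \<xi>)[hs]\<close>. The constant in the estimate is allowed to depend on \<open>\<beta>\<close>.
\<close>

definition nonhom_symbol :: "real \<Rightarrow> real \<Rightarrow> real \<Rightarrow> real \<Rightarrow> nat \<Rightarrow> nsym \<Rightarrow> bool" where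
  "nonhom_symbol d s0 r \<mu>' p a \<longleftrightarrow>
     (\<forall>U\<in>sball s0 r. \<forall>x \<xi>. a U (x + 2 * pi) \<xi> = a U x \<xi>) \<and>
     (\<forall>s\<ge>s0. \<exists>r0 D. 0 < r0 \<and> r0 < r \<and>
        (\<forall>x \<xi>. frechet_tower s (sball s0 r0 \<inter> {U. vsob s U}) (\<lambda>k z e. cmod z \<le> e)
                  (\<lambda>k. d * real k \<le> s - s0) (\<lambda>U. a U x \<xi>) (\<lambda>k U hs. D k U hs x \<xi>)) \<and>
        (\<forall>k U. d * real k \<le> s - s0 \<and> U \<in> sball s0 r0 \<and> vsob s U \<longrightarrow>
           (\<forall>x \<xi>. multilinear_on \<real> {h. vsob s h} k (\<lambda>hs. D k U hs x \<xi>))) \<and>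
        (\<forall>\<beta>. \<exists>C>0. \<forall>\<alpha> k U hs. real \<alpha> + d * real k \<le> s - s0 \<and>
           U \<in> sball s0 r0 \<and> vsob s U \<and> length hs = k \<and> (\<forall>h\<in>set hs. vsob s h) \<longrightarrow>
             has_pds \<alpha> (D k U hs) \<and>
             (\<forall>x \<xi>. cmod (pd \<alpha> \<beta> (D k U hs) x \<xi>)
                \<le> C * jap \<xi> powr (\<mu>' - real \<beta>) * gain p s0 (vsob_norm (s0 + real \<alpha>)) U hs)))"

text \<open>
  An element \<open>\<Sum>\<^sub>q a\<^sub>q + a\<^sub>N\<close> of \<open>\<Sigma>\<Gamma>\<close> is given together with its (unique) decomposition:
  the first component is \<open>q \<mapsto> a\<^sub>q\<close>, the second one is \<open>a\<^sub>N\<close>.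
\<close>

type_synonym ssym = "(nat \<Rightarrow> hsym) \<times> nsym"

definition sum_symbol :: "real \<Rightarrow> real \<Rightarrow> real \<Rightarrow> nat \<Rightarrow> real \<Rightarrow> nat \<Rightarrow> ssym \<Rightarrow> bool" where
  "sum_symbol d s0 r N \<mu>' p a \<longleftrightarrow>
     (\<forall>q\<in>{p..<N}. hom_symbol \<mu>' q (fst a q)) \<and> nonhom_symbol d s0 r \<mu>' N (snd a)"

text \<open>
  A homogeneous symbol is a priori defined on smooth arguments; on the diagonal it is extended to
  \<open>U\<close> in \<open>H\<^sup>s\<close> (\<open>s\<close> large) by the absolutely convergent series \<open>\<Sum>\<^sub>n a(\<Pi>\<^sub>n (U, \<dots>, U))\<close>.
\<close>

definition hom_eval :: "nat \<Rightarrow> hsym \<Rightarrow> nsym" where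
  "hom_eval q a U x \<xi> = (\<Sum>\<^sub>\<infinity>ns\<in>{ns. length ns = q}. a (vprojs ns (replicate q U)) x \<xi>)"

definition sum_eval :: "nat \<Rightarrow> nat \<Rightarrow> ssym \<Rightarrow> nsym" where
  "sum_eval N p a U x \<xi> = (\<Sum>q\<in>{p..<N}. hom_eval q (fst a q) U x \<xi>) + snd a U x \<xi>"

definition x_independent :: "real \<Rightarrow> real \<Rightarrow> nat \<Rightarrow> nat \<Rightarrow> ssym \<Rightarrow> bool" where
  "x_independent s0 r N p a \<longleftrightarrow>
     (\<forall>q\<in>{p..<N}. \<forall>Us x y \<xi>. length Us = q \<and> set Us \<subseteq> smooth_vecs \<longrightarrow> fst a q Us x \<xi> = fst a q Us y \<xi>) \<and>
     (\<forall>U\<in>sball s0 r. \<forall>x y \<xi>. snd a U x \<xi> = snd a U y \<xi>)"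

definition xi_independent :: "real \<Rightarrow> real \<Rightarrow> nat \<Rightarrow> nat \<Rightarrow> ssym \<Rightarrow> bool" where
  "xi_independent s0 r N p a \<longleftrightarrow>
     (\<forall>q\<in>{p..<N}. \<forall>Us x \<xi> \<eta>. length Us = q \<and> set Us \<subseteq> smooth_vecs \<longrightarrow> fst a q Us x \<xi> = fst a q Us x \<eta>) \<and>
     (\<forall>U\<in>sball s0 r. \<forall>x \<xi> \<eta>. snd a U x \<xi> = snd a U x \<eta>)"

definition real_valued :: "real \<Rightarrow> real \<Rightarrow> nat \<Rightarrow> nat \<Rightarrow> ssym \<Rightarrow> bool" where
  "real_valued s0 r N p a \<longleftrightarrow>
     (\<forall>u x \<xi>. couple u \<in> sball s0 r \<longrightarrow> sum_eval N p a (couple u) x \<xi> \<in> \<real>)"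

definition sum_function :: "real \<Rightarrow> real \<Rightarrow> real \<Rightarrow> nat \<Rightarrow> nat \<Rightarrow> ssym \<Rightarrow> bool" where
  "sum_function d s0 r N p a \<longleftrightarrow> sum_symbol d s0 r N 0 p a \<and> xi_independent s0 r N p a"

text \<open>The conjugate symbol (as a function on couples) and the reflection \<open>\<xi> \<mapsto> - \<xi>\<close>.\<close>

definition sym_conj :: "ssym \<Rightarrow> ssym" where
  "sym_conj a = (\<lambda>q Us x \<xi>. cnj (fst a q (map vconj Us) x \<xi>), \<lambda>U x \<xi>. cnj (snd a (vconj U) x \<xi>))"

definition sym_refl :: "ssym \<Rightarrow> ssym" where
  "sym_refl a = (\<lambda>q Us x \<xi>. fst a q Us x (- \<xi>), \<lambda>U x \<xi>. snd a U x (- \<xi>))"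

section \<open>Paradifferential quantization\<close>

text \<open>A cut-off \<open>X \<xi>' \<xi>\<close> has the list \<open>\<xi>'\<close> of length \<open>p\<close> as an argument in \<open>\<real>\<^sup>p\<close>.\<close>

type_synonym cutoff_fun = "real list \<Rightarrow> real \<Rightarrow> real"

text \<open>Partial derivative in \<open>\<xi>'\<^sub>i\<close> for \<open>i < p\<close>, and in \<open>\<xi>\<close> for \<open>i = p\<close>.\<close>

definition slice :: "nat \<Rightarrow> nat \<Rightarrow> cutoff_fun \<Rightarrow> real list \<Rightarrow> real \<Rightarrow> real \<Rightarrow> real" where
  "slice p i X ys \<xi> = (\<lambda>t. if i < p then X (ys[i := t]) \<xi> else X ys t)"

definition cpd :: "nat \<Rightarrow> nat \<Rightarrow> cutoff_fun \<Rightarrow> cutoff_fun" where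
  "cpd p i X = (\<lambda>ys \<xi>. deriv (slice p i X ys \<xi>) (if i < p then ys ! i else \<xi>))"

definition rnorm :: "real list \<Rightarrow> real" where
  "rnorm ys = sqrt (\<Sum>y\<leftarrow>ys. y\<^sup>2)"

text \<open>
  The first condition states that all iterated partial derivatives exist and satisfy the symbol
  bounds. As these bound the derivatives of the next order, each of them is Lipschitz, so
  \<open>X\<close> is \<open>C\<^sup>\<infinity>\<close> and the order of differentiation is irrelevant.
\<close>

definition cutoff :: "real \<Rightarrow> nat \<Rightarrow> cutoff_fun \<Rightarrow> bool" where
  "cutoff \<delta> p X \<longleftrightarrow>
     (\<forall>ds. set ds \<subseteq> {..p} \<longrightarrow>
        (\<forall>i ys \<xi>. i \<le> p \<and> length ys = p \<longrightarrow>
           slice p i (foldr (cpd p) ds X) ys \<xi> differentiable (at (if i < p then ys ! i else \<xi>))) \<and>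
        (\<exists>C. \<forall>ys \<xi>. length ys = p \<longrightarrow>
           \<bar>foldr (cpd p) ds X ys \<xi>\<bar> \<le> C * jap \<xi> powr (- real (length ds)))) \<and>
     (\<forall>ys \<xi>. length ys = p \<longrightarrow> X ys (- \<xi>) = X ys \<xi> \<and>
        (\<forall>i<p. X (ys[i := - ys ! i]) \<xi> = X ys \<xi>)) \<and>
     (\<forall>ys \<xi>. length ys = p \<and> X ys \<xi> \<noteq> 0 \<longrightarrow> rnorm ys \<le> \<delta> * jap \<xi>) \<and>
     (\<forall>ys \<xi>. length ys = p \<and> rnorm ys \<le> \<delta> / 2 * jap \<xi> \<longrightarrow> X ys \<xi> = 1)"

text \<open>Weyl quantization, given the \<open>x\<close>-Fourier coefficients \<open>b \<eta> \<xi>\<close> of the truncated symbol.\<close>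

definition weyl :: "(int \<Rightarrow> real \<Rightarrow> complex) \<Rightarrow> fn \<Rightarrow> fn" where
  "weyl b v = (\<lambda>k. (\<Sum>\<^sub>\<infinity>j. b (k - j) (of_int (k + j) / 2) * v j) / of_real (sqrt (2 * pi)))"

definition hom_trunc :: "cutoff_fun \<Rightarrow> nat \<Rightarrow> hsym \<Rightarrow> vec list \<Rightarrow> int \<Rightarrow> real \<Rightarrow> complex" where
  "hom_trunc X q a Us \<eta> \<xi> =
     fourier (\<lambda>x. \<Sum>\<^sub>\<infinity>ns\<in>{ns. length ns = q}. of_real (X (map real ns) \<xi>) * a (vprojs ns Us) x \<xi>) \<eta>"

definition nonhom_trunc :: "cutoff_fun \<Rightarrow> nsym \<Rightarrow> vec \<Rightarrow> int \<Rightarrow> real \<Rightarrow> complex" where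
  "nonhom_trunc X a U \<eta> \<xi> = of_real (X [of_int \<eta>] \<xi>) * fourier (\<lambda>x. a U x \<xi>) \<eta>"

text \<open>\<open>X\<close> is the cut-off for non-homogeneous symbols, \<open>Xs q\<close> the one for \<open>q\<close>-homogeneous symbols.\<close>

definition op_bw :: "cutoff_fun \<Rightarrow> (nat \<Rightarrow> cutoff_fun) \<Rightarrow> nat \<Rightarrow> nat \<Rightarrow> ssym \<Rightarrow> vec \<Rightarrow> fn \<Rightarrow> fn" where
  "op_bw X Xs N p a U v =
     (\<Sum>q\<in>{p..<N}. weyl (hom_trunc (Xs q) q (fst a q) (replicate q U)) v)
       + weyl (nonhom_trunc X (snd a) U) v"

section \<open>Smoothing operators\<close>

type_synonym hop = "vec list \<Rightarrow> fn \<Rightarrow> fn"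
type_synonym nop = "vec \<Rightarrow> fn \<Rightarrow> fn"
type_synonym sop = "(nat \<Rightarrow> hop) \<times> nop"

definition max1 :: "real list \<Rightarrow> real" where
  "max1 ys = rev (sort ys) ! 0"

definition max2 :: "real list \<Rightarrow> real" where
  "max2 ys = rev (sort ys) ! 1"

definition hom_smoothing :: "real \<Rightarrow> nat \<Rightarrow> hop \<Rightarrow> bool" where
  "hom_smoothing \<rho> p R \<longleftrightarrow>
     (\<forall>Us v. length Us = p \<and> set Us \<subseteq> smooth_vecs \<and> v \<in> smooth_fns \<longrightarrow> R Us v \<in> smooth_fns) \<and>
     (\<forall>v\<in>smooth_fns. \<forall>n. multilinear_on UNIV smooth_vecs p (\<lambda>Us. R Us v n)) \<and>
     (\<forall>Us. length Us = p \<and> set Us \<subseteq> smooth_vecs \<longrightarrow> linear_fn_on smooth_fns (R Us)) \<and>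
     (\<forall>v\<in>smooth_fns. symmetric_on smooth_vecs p (\<lambda>Us. R Us v)) \<and>
     (\<exists>\<mu>\<ge>0. \<exists>C>0. \<forall>n0 ns n' Us v.
        length ns = p \<and> length Us = p \<and> set Us \<subseteq> smooth_vecs \<and> v \<in> smooth_fns \<longrightarrow>
        (let js = map (\<lambda>n. jap (real n)) (ns @ [n']) in
          sob_norm 0 (proj n0 (R (vprojs ns Us) (proj n' v)))
            \<le> C * (max2 js powr (\<rho> + \<mu>) / max1 js powr \<rho>)
                * (\<Prod>U\<leftarrow>vprojs ns Us. vsob_norm 0 U) * sob_norm 0 (proj n' v))) \<and>
     (\<forall>n0 ns n' Us v.
        length ns = p \<and> length Us = p \<and> set Us \<subseteq> smooth_vecs \<and> v \<in> smooth_fns \<and>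
        proj n0 (R (vprojs ns Us) (proj n' v)) \<noteq> 0 \<longrightarrow> signed_zero (n0 # ns @ [n'])) \<and>
     (\<forall>\<theta> Us v. length Us = p \<and> set Us \<subseteq> smooth_vecs \<and> v \<in> smooth_fns \<longrightarrow>
        R (map (vshift \<theta>) Us) (shift \<theta> v) = shift \<theta> (R Us v))"

definition nonhom_smoothing :: "real \<Rightarrow> real \<Rightarrow> real \<Rightarrow> real \<Rightarrow> nat \<Rightarrow> nop \<Rightarrow> bool" where
  "nonhom_smoothing d s0 r \<rho> p R \<longleftrightarrow>
     (\<forall>V\<in>sball s0 r. linear_fn_on {u. sob s0 u} (R V)) \<and>
     (\<forall>s\<ge>s0. \<exists>C>0. \<exists>r0. \<exists>D. 0 < r0 \<and> r0 < r \<and>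
        (\<forall>u. sob s u \<longrightarrow>
          frechet_tower s (sball s0 r0 \<inter> {V. vsob s V})
            (\<lambda>k z e. sob (s + \<rho> - d * real k) z \<and> sob_norm (s + \<rho> - d * real k) z \<le> e)
            (\<lambda>k. d * real k \<le> s - s0) (\<lambda>V. R V u) (\<lambda>k V hs. D k V hs u)) \<and>
        (\<forall>k V u. d * real k \<le> s - s0 \<and> V \<in> sball s0 r0 \<and> vsob s V \<and> sob s u \<longrightarrow>
           (\<forall>n. multilinear_on \<real> {h. vsob s h} k (\<lambda>hs. D k V hs u n)) \<and>
           (\<forall>hs. length hs = k \<and> (\<forall>h\<in>set hs. vsob s h) \<longrightarrow>
              sob (s + \<rho> - d * real k) (D k V hs u) \<and>
              sob_norm (s + \<rho> - d * real k) (D k V hs u)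
                \<le> C * (gain p s0 (vsob_norm s) V hs * sob_norm s0 u
                     + vsob_norm s0 V ^ (p - k) * sob_norm s u * (\<Prod>h\<leftarrow>hs. vsob_norm s0 h)))))"

definition sum_smoothing :: "real \<Rightarrow> real \<Rightarrow> real \<Rightarrow> nat \<Rightarrow> real \<Rightarrow> nat \<Rightarrow> sop \<Rightarrow> bool" where
  "sum_smoothing d s0 r N \<rho> p R \<longleftrightarrow>
     (\<forall>q\<in>{p..<N}. hom_smoothing \<rho> q (fst R q)) \<and> nonhom_smoothing d s0 r \<rho> N (snd R)"

definition hop_eval :: "nat \<Rightarrow> hop \<Rightarrow> nop" where
  "hop_eval q R U v =
     (\<lambda>n. \<Sum>\<^sub>\<infinity>(ns, n')\<in>{ns. length ns = q} \<times> UNIV. R (vprojs ns (replicate q U)) (proj n' v) n)"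

definition sop_eval :: "nat \<Rightarrow> nat \<Rightarrow> sop \<Rightarrow> nop" where
  "sop_eval N p R U v = (\<Sum>q\<in>{p..<N}. hop_eval q (fst R q) U v) + snd R U v"

text \<open>
  A matrix \<open>R \<sigma> \<sigma>'\<close> of operators (row \<open>\<sigma>\<close>, column \<open>\<sigma>'\<close>) is real-to-real when its second row is
  obtained from the first one by \<open>R(U)[V] \<mapsto> conj (R(U)[conj V])\<close>.
\<close>

definition real_to_real :: "real \<Rightarrow> real \<Rightarrow> nat \<Rightarrow> nat \<Rightarrow> (sign \<Rightarrow> sign \<Rightarrow> sop) \<Rightarrow> bool" where
  "real_to_real s0 r N p R \<longleftrightarrow>
     (\<forall>\<sigma>' u v. couple u \<in> sball s0 r \<and> sob s0 v \<longrightarrow>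
        sop_eval N p (R Mi \<sigma>') (couple u) v = fconj (sop_eval N p (R Pl (opp \<sigma>')) (couple u) (fconj v)))"

section \<open>Resonant parts\<close>

definition resonant :: "nat \<Rightarrow> (sign list \<times> int list) set" where
  "resonant q = {(\<sigma>s, js). even q \<and> length \<sigma>s = q \<and> length js = q \<and>
     (\<exists>\<pi>. \<pi> permutes {..<q} \<and> (\<forall>i<q div 2.
        \<sigma>s ! \<pi> i = opp (\<sigma>s ! \<pi> (q div 2 + i)) \<and> \<bar>js ! \<pi> i\<bar> = \<bar>js ! \<pi> (q div 2 + i)\<bar>))}"

definition momentum :: "sign list \<Rightarrow> int list \<Rightarrow> int" where
  "momentum \<sigma>s js = (\<Sum>i<length js. sg (\<sigma>s ! i) * js ! i)"

text \<open>
  The coefficient of \<open>u\<^sup>\<sigma>\<^sup>1\<^sub>j\<^sub>1 \<dots> u\<^sup>\<sigma>\<^sup>p\<^sub>j\<^sub>p\<close> is the value on the corresponding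
  basis vectors. The resonant part is kept as a multilinear map, since the quantization cut-off acts on that
  level; the argument \<open>x\<close> is irrelevant for \<open>x\<close>-independent symbols.
\<close>

definition res_hsym :: "nat \<Rightarrow> hsym \<Rightarrow> hsym" where
  "res_hsym q a Us x \<xi> =
     (\<Sum>\<^sub>\<infinity>(\<sigma>s, js)\<in>{(\<sigma>s, js) \<in> resonant q. momentum \<sigma>s js = 0}.
        a (map2 vbasis \<sigma>s js) x \<xi> * (\<Prod>i<q. coef (\<sigma>s ! i) (js ! i) (Us ! i)))"

definition res_sym :: "ssym \<Rightarrow> ssym" where
  "res_sym a = (\<lambda>q. res_hsym q (fst a q), snd a)"

text \<open>Diagonal entries of the resonant part of \<open>diag(a(U; \<xi>), conj (a(U; - \<xi>)))\<close>.\<close>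

definition res_diag :: "ssym \<Rightarrow> sign \<Rightarrow> ssym" where
  "res_diag a \<sigma> = (case \<sigma> of Pl \<Rightarrow> res_sym a | Mi \<Rightarrow> sym_refl (res_sym (sym_conj a)))"

text \<open>
  Entry \<open>(\<sigma>, \<sigma>')\<close> of the resonant part of a matrix of \<open>q\<close>-homogeneous smoothing operators;
  \<open>res_hop_coef\<close> is the coefficient \<open>(R(U))\<^sub>\<sigma>\<^sub>,\<^sub>j\<^sup>\<sigma>\<^sup>'\<^sup>,\<^sup>k\<close> with its defining sum restricted.
\<close>

definition res_hop_coef :: "sign \<Rightarrow> sign \<Rightarrow> nat \<Rightarrow> hop \<Rightarrow> vec list \<Rightarrow> int \<Rightarrow> int \<Rightarrow> complex" where
  "res_hop_coef \<sigma> \<sigma>' q R Us j k =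
     (\<Sum>\<^sub>\<infinity>(\<sigma>s, js)\<in>{(\<sigma>s, js). length \<sigma>s = q \<and> length js = q \<and>
          momentum \<sigma>s js = sg \<sigma> * j - sg \<sigma>' * k \<and>
          (\<sigma>s @ [opp \<sigma>, \<sigma>'], js @ [j, k]) \<in> resonant (q + 2)}.
        R (map2 vbasis \<sigma>s js) (fbasis (sg \<sigma>' * k)) (sg \<sigma> * j)
          * (\<Prod>i<q. coef (\<sigma>s ! i) (js ! i) (Us ! i)))"

definition res_hop :: "sign \<Rightarrow> sign \<Rightarrow> nat \<Rightarrow> hop \<Rightarrow> hop" where
  "res_hop \<sigma> \<sigma>' q R Us v =
     (\<lambda>n. \<Sum>\<^sub>\<infinity>k. res_hop_coef \<sigma> \<sigma>' q R Us (sg \<sigma> * n) k * v (sg \<sigma>' * k))"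

definition res_sop_apply :: "sign \<Rightarrow> sign \<Rightarrow> nat \<Rightarrow> nat \<Rightarrow> sop \<Rightarrow> vec \<Rightarrow> fn \<Rightarrow> fn" where
  "res_sop_apply \<sigma> \<sigma>' N p R U v =
     (\<Sum>q\<in>{p..<N}. res_hop \<sigma> \<sigma>' q (fst R q) (replicate q U) v) + snd R U v"

section \<open>The normal form system\<close>

text \<open>
  The vector field \<open>\<i>E\<Omega>W + \<i>E Op\<^sup>B\<^sup>W(\<lbrakk>M\<rbrakk>(W; \<xi>))W + \<lbrakk>Q\<rbrakk>(W)W\<close>, where \<open>M\<close> is the diagonal matrix
  generated by the symbol \<open>a\<close>.
\<close>

definition nf_field ::
  "cutoff_fun \<Rightarrow> (nat \<Rightarrow> cutoff_fun) \<Rightarrow> nat \<Rightarrow> (int \<Rightarrow> real) \<Rightarrow> ssym \<Rightarrow> (sign \<Rightarrow> sign \<Rightarrow> sop) \<Rightarrow> vec \<Rightarrow> vec" where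
  "nf_field X Xs N \<omega> a Q W = (\<lambda>\<sigma> n.
     \<i> * of_int (sg \<sigma>) * of_real (\<omega> n) * W \<sigma> n
     + \<i> * of_int (sg \<sigma>) * op_bw X Xs N 2 (res_diag a \<sigma>) W (W \<sigma>) n
     + (\<Sum>\<sigma>'\<in>{Pl, Mi}. res_sop_apply \<sigma> \<sigma>' N 2 (Q \<sigma> \<sigma>') W (W \<sigma>') n))"

text \<open>The bilinear pairing \<open>\<integral> (F\<^sup>+ G\<^sup>+ + F\<^sup>- G\<^sup>-) dx\<close>, in Fourier coefficients.\<close>

definition pairing :: "vec \<Rightarrow> vec \<Rightarrow> complex" where
  "pairing F G = (\<Sum>\<sigma>\<in>{Pl, Mi}. \<Sum>\<^sub>\<infinity>n. F \<sigma> n * G \<sigma> (- n))"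

text \<open>
  \<open>G = (\<partial>\<^sub>u H, \<partial>\<^sub>v H)\<close>, \<open>v = conj u\<close>, is the \<open>L\<^sup>2\<close>-gradient at \<open>u\<close> of the real function \<open>H\<close> on couples:
  the Frechet differential of \<open>H\<close> in \<open>H\<^sup>s\<close> is \<open>h \<mapsto> pairing G (couple h)\<close>.
\<close>

definition has_gradient :: "real \<Rightarrow> (vec \<Rightarrow> real) \<Rightarrow> vec \<Rightarrow> fn \<Rightarrow> bool" where
  "has_gradient s H G u \<longleftrightarrow> vsob 0 G \<and>
     (\<forall>\<epsilon>>0. \<exists>\<delta>>0. \<forall>h. sob s h \<and> sob_norm s h < \<delta> \<longrightarrow>
        cmod (of_real (H (couple (u + h)) - H (couple u)) - pairing G (couple h)) \<le> \<epsilon> * sob_norm s h)"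

definition hamiltonian_field :: "real \<Rightarrow> real \<Rightarrow> (vec \<Rightarrow> vec) \<Rightarrow> bool" where
  "hamiltonian_field s0 r X \<longleftrightarrow>
     (\<exists>H. \<forall>u. couple u \<in> sball s0 r \<longrightarrow>
        (\<exists>G. has_gradient s0 H G u \<and>
             X (couple u) Pl = (\<lambda>n. \<i> * G Mi n) \<and> X (couple u) Mi = (\<lambda>n. - \<i> * G Pl n)))"

definition cont_curve :: "real \<Rightarrow> real set \<Rightarrow> (real \<Rightarrow> vec) \<Rightarrow> bool" where
  "cont_curve s I W \<longleftrightarrow>
     (\<forall>t\<in>I. vsob s (W t) \<and> ((\<lambda>\<tau>. vsob_norm s (W \<tau> - W t)) \<longlongrightarrow> 0) (at t within I))"

definition has_curve_derivative :: "real \<Rightarrow> real set \<Rightarrow> (real \<Rightarrow> vec) \<Rightarrow> (real \<Rightarrow> vec) \<Rightarrow> bool" where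
  "has_curve_derivative s I W W' \<longleftrightarrow>
     (\<forall>t\<in>I. ((\<lambda>\<tau>. vsob_norm s (\<lambda>\<sigma> n. (W \<tau> \<sigma> n - W t \<sigma> n) / of_real (\<tau> - t) - W' t \<sigma> n)) \<longlongrightarrow> 0)
        (at t within I))"

text \<open>\<open>W \<in> C\<^sup>0(I; H\<^sup>s) \<inter> C\<^sup>1(I; H\<^sup>s\<^sup>-\<^sup>m)\<close> solves \<open>W' = X(W)\<close>, with values in the domain \<open>B\<close> of \<open>X\<close>.\<close>

definition is_solution :: "real \<Rightarrow> real \<Rightarrow> real set \<Rightarrow> vec set \<Rightarrow> (vec \<Rightarrow> vec) \<Rightarrow> (real \<Rightarrow> vec) \<Rightarrow> bool" where
  "is_solution m s I B X W \<longleftrightarrow>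
     cont_curve s I W \<and> (\<forall>t\<in>I. W t \<in> B) \<and>
     (\<exists>W'. cont_curve (s - m) I W' \<and> has_curve_derivative (s - m) I W W' \<and> (\<forall>t\<in>I. W' t = X (W t)))"

end

theory Submission
  imports Defs
begin

text \<open>
  Resonant monomials are invariant under multiplying all modes \<open>\<plusminus> n\<close> by a common phase, that is under the
  flow of the super action \<open>J\<^sub>n = \<Sum>\<^bsub>\<bar>k\<bar> = n\<^esub> \<bar>u\<^sub>k\<bar>\<^sup>2\<close>. Hence the contribution of each homogeneous resonant term to
  \<open>dJ\<^sub>n/dt\<close> is constant along the orbits of this flow. Up to sign, \<open>dJ\<^sub>n/dt\<close> is the derivative of the Hamiltonian along the
  orbit, and the orbits are closed, so it vanishes somewhere on the orbit of \<open>\<epsilon>u\<close> by Rolle's theorem.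
  Comparing orders in \<open>\<epsilon>\<close>, the homogeneous terms do not contribute to \<open>dJ\<^sub>n/dt\<close> at all. Since the
  symbol is real and independent of \<open>x\<close>, the paradifferential remainder does not contribute either, and only the
  smoothing remainder, which is \<open>O(\<parallel>w\<parallel>\<^sup>N\<^sup>+\<^sup>1)\<close> in \<open>H\<^sup>s\<close>, enters the energy estimate.
  The argument never uses convergence of the series defining the homogeneous terms.
\<close>

section \<open>Sobolev norms\<close>

lemma jap_ge_1: "1 \<le> jap y"
  by (simp add: jap_def)

lemma jap_pos: "0 < jap y"
  using jap_ge_1[of y] by linarith

lemma jap_minus [simp]: "jap (- y) = jap y"
  by (simp add: jap_def)

lemma jap_abs [simp]: "jap \<bar>y\<bar> = jap y"
  by (simp add: jap_def)

lemma sob_term_eq_square: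
  "jap y powr (2 * s) * (cmod z)\<^sup>2 = (jap y powr s * cmod z)\<^sup>2"
  using jap_pos[of y] by (simp add: power_mult_distrib powr_power mult.commute)

lemma sob_norm_nonneg: "0 \<le> sob_norm s u"
  unfolding sob_norm_def by (intro real_sqrt_ge_zero infsum_nonneg) simp

lemma sob_norm_square: "(sob_norm s u)\<^sup>2 = (\<Sum>\<^sub>\<infinity>n. jap (of_int n) powr (2 * s) * (cmod (u n))\<^sup>2)"
  unfolding sob_norm_def by (intro real_sqrt_pow2 infsum_nonneg) simp

text \<open>Together with \<open>sob_norm_leI\<close> this describes the Sobolev norm as the
  supremum of its finite truncations. Minkowski and Cauchy-Schwarz for \<open>L2_set\<close> then
  carry over, and summability comes with every uniform bound.\<close>

lemma L2_set_le_sob_norm: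
  assumes "sob s u" "finite F"
  shows "L2_set (\<lambda>n. jap (of_int n) powr s * cmod (u n)) F \<le> sob_norm s u"
proof -
  have "(\<Sum>n\<in>F. jap (of_int n) powr (2 * s) * (cmod (u n))\<^sup>2)
      \<le> (\<Sum>\<^sub>\<infinity>n. jap (of_int n) powr (2 * s) * (cmod (u n))\<^sup>2)"
    using assms by (intro finite_sum_le_infsum) (auto simp: sob_def)
  then show ?thesis
    unfolding L2_set_def sob_norm_def sob_term_eq_square by (intro real_sqrt_le_mono)
qed

lemma sob_norm_leI:
  assumes "\<And>F. finite F \<Longrightarrow> L2_set (\<lambda>n. jap (of_int n) powr s * cmod (u n)) F \<le> b"
  shows "sob s u" and "sob_norm s u \<le> b"
proof -
  have b: "0 \<le> b" using assms[of "{}"] by simp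
  have F: "(\<Sum>n\<in>F. jap (of_int n) powr (2 * s) * (cmod (u n))\<^sup>2) \<le> b\<^sup>2" if "finite F" for F
    using assms[OF that] b sqrt_le_D unfolding L2_set_def sob_term_eq_square by blast
  show *: "sob s u"
    unfolding sob_def using F
    by (intro nonneg_bdd_above_summable_on bdd_aboveI2) auto
  have "(sob_norm s u)\<^sup>2 \<le> b\<^sup>2"
    unfolding sob_norm_square using * F unfolding sob_def by (intro infsum_le_finite_sums) auto
  then show "sob_norm s u \<le> b" using b power2_le_imp_le by blast
qed

lemma coeff_le_sob_norm:
  assumes "sob s u"
  shows "jap (of_int n) powr s * cmod (u n) \<le> sob_norm s u"
  using L2_set_le_sob_norm[OF assms, of "{n}"] by simp

lemma sob_dominated:
  assumes "sob s' v" "\<And>n. jap (of_int n) powr s * cmod (u n) \<le> jap (of_int n) powr s' * cmod (v n)"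
  shows "sob s u" and "sob_norm s u \<le> sob_norm s' v"
proof -
  have "L2_set (\<lambda>n. jap (of_int n) powr s * cmod (u n)) F \<le> sob_norm s' v" if "finite F" for F
    using L2_set_mono[of F "\<lambda>n. jap (of_int n) powr s * cmod (u n)"
        "\<lambda>n. jap (of_int n) powr s' * cmod (v n)"] L2_set_le_sob_norm[OF assms(1) that] assms(2)
    by fastforce
  from sob_norm_leI[of s u, OF this] show "sob s u" "sob_norm s u \<le> sob_norm s' v" by auto
qed

lemma
  assumes "sob s u" "s' \<le> s"
  shows sob_mono: "sob s' u" and sob_norm_mono: "sob_norm s' u \<le> sob_norm s u"
proof -
  have "jap (of_int n) powr s' * cmod (u n) \<le> jap (of_int n) powr s * cmod (u n)" for n
    using assms(2) jap_ge_1 by (intro mult_right_mono powr_mono) auto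
  from sob_dominated[OF assms(1) this] show "sob s' u" "sob_norm s' u \<le> sob_norm s u" by auto
qed

lemma
  assumes "sob s u" "sob s v"
  shows sob_add: "sob s (u + v)" and sob_norm_triangle: "sob_norm s (u + v) \<le> sob_norm s u + sob_norm s v"
proof -
  have "L2_set (\<lambda>n. jap (of_int n) powr s * cmod ((u + v) n)) F \<le> sob_norm s u + sob_norm s v"
    if "finite F" for F
  proof -
    have "L2_set (\<lambda>n. jap (of_int n) powr s * cmod ((u + v) n)) F
        \<le> L2_set (\<lambda>n. jap (of_int n) powr s * cmod (u n) + jap (of_int n) powr s * cmod (v n)) F"
      by (rule L2_set_mono) (auto simp flip: distrib_left intro!: mult_left_mono norm_triangle_ineq)
    also have "\<dots> \<le> L2_set (\<lambda>n. jap (of_int n) powr s * cmod (u n)) F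
        + L2_set (\<lambda>n. jap (of_int n) powr s * cmod (v n)) F"
      by (rule L2_set_triangle_ineq)
    also have "\<dots> \<le> sob_norm s u + sob_norm s v"
      using assms that by (intro add_mono L2_set_le_sob_norm)
    finally show ?thesis .
  qed
  from sob_norm_leI[of s "u + v", OF this]
  show "sob s (u + v)" "sob_norm s (u + v) \<le> sob_norm s u + sob_norm s v" by auto
qed

lemma
  assumes "sob s u"
  shows sob_scale: "sob s (\<lambda>n. c * u n)"
    and sob_norm_scale: "sob_norm s (\<lambda>n. c * u n) = cmod c * sob_norm s u"
proof -
  have eq: "jap (of_int n) powr (2 * s) * (cmod (c * u n))\<^sup>2
      = (cmod c)\<^sup>2 * (jap (of_int n) powr (2 * s) * (cmod (u n))\<^sup>2)" for n :: int
    by (simp add: norm_mult power_mult_distrib)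
  show "sob s (\<lambda>n. c * u n)"
    using assms unfolding sob_def eq by (rule summable_on_cmult_right)
  show "sob_norm s (\<lambda>n. c * u n) = cmod c * sob_norm s u"
    unfolding sob_norm_def eq infsum_cmult_right' by (simp add: real_sqrt_mult)
qed

lemma sob_diff:
  assumes "sob s u" "sob s v"
  shows "sob s (u - v)"
  using sob_add[OF assms(1) sob_scale[OF assms(2), of "-1"]] by (simp add: plus_fun_def fun_diff_def)

text \<open>The weighted l1 bound is crude, but being a finite sum of moduli of coefficients it can
  be followed mode by mode along difference quotients.\<close>

lemma
  assumes "finite K" "\<And>n. n \<notin> K \<Longrightarrow> h n = 0"
  shows sob_finite_support: "sob s h"
    and sob_norm_finite_support: "sob_norm s h \<le> (\<Sum>n\<in>K. jap (of_int n) powr s * cmod (h n))"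
proof -
  have "L2_set (\<lambda>n. jap (of_int n) powr s * cmod (h n)) F \<le> (\<Sum>n\<in>K. jap (of_int n) powr s * cmod (h n))"
    if "finite F" for F
  proof -
    have "L2_set (\<lambda>n. jap (of_int n) powr s * cmod (h n)) F \<le> (\<Sum>n\<in>F. jap (of_int n) powr s * cmod (h n))"
      by (rule L2_set_le_sum) simp
    also have "\<dots> = (\<Sum>n\<in>F \<inter> K. jap (of_int n) powr s * cmod (h n))"
      using that assms by (intro sum.mono_neutral_right) auto
    also have "\<dots> \<le> (\<Sum>n\<in>K. jap (of_int n) powr s * cmod (h n))"
      using assms by (intro sum_mono2) auto
    finally show ?thesis .
  qed
  from sob_norm_leI[of s h, OF this]
  show "sob s h" "sob_norm s h \<le> (\<Sum>n\<in>K. jap (of_int n) powr s * cmod (h n))" by auto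
qed

lemma sob_norm_abs_diff_le:
  assumes "sob s u" "sob s v"
  shows "\<bar>sob_norm s u - sob_norm s v\<bar> \<le> sob_norm s (u - v)"
proof -
  have d: "sob s (u - v)" "sob s (v - u)" using assms by (auto intro: sob_diff)
  have "sob_norm s (v - u) = sob_norm s (u - v)"
    by (simp add: sob_norm_def norm_minus_commute)
  moreover have "sob_norm s u \<le> sob_norm s (u - v) + sob_norm s v"
    using sob_norm_triangle[OF d(1) assms(2)] by simp
  moreover have "sob_norm s v \<le> sob_norm s (v - u) + sob_norm s u"
    using sob_norm_triangle[OF d(2) assms(1)] by simp
  ultimately show ?thesis by linarith
qed

lemma
  shows sob_fconj [simp]: "sob s (fconj u) \<longleftrightarrow> sob s u"
    and sob_norm_fconj [simp]: "sob_norm s (fconj u) = sob_norm s u"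
proof -
  have b: "bij_betw uminus (UNIV :: int set) UNIV" by (rule bij_uminus)
  show "sob s (fconj u) \<longleftrightarrow> sob s u"
    unfolding sob_def fconj_def
    using summable_on_reindex_bij_betw[OF b, of "\<lambda>n. jap (of_int n) powr (2 * s) * (cmod (u n))\<^sup>2"]
    by simp
  show "sob_norm s (fconj u) = sob_norm s u"
    unfolding sob_norm_def fconj_def
    using infsum_reindex_bij_betw[OF b, of "\<lambda>n. jap (of_int n) powr (2 * s) * (cmod (u n))\<^sup>2"]
    by simp
qed

section \<open>Couples and their norms\<close>

lemma couple_simps [simp]: "couple u Pl = u" "couple u Mi = fconj u"
  by (simp_all add: couple_def)

lemma all_sign: "(\<forall>\<sigma>. P \<sigma>) \<longleftrightarrow> P Pl \<and> P Mi"
  by (metis sign.exhaust)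

lemma vsob_couple [simp]: "vsob s (couple u) \<longleftrightarrow> sob s u"
  by (simp add: vsob_def all_sign)

lemma vsob_norm_couple: "vsob_norm s (couple u) = sqrt 2 * sob_norm s u"
  using sob_norm_nonneg[of s u] by (simp add: vsob_norm_def real_sqrt_mult flip: mult_2)

lemma sob_norm_le_vsob_norm: "sob_norm s (U \<sigma>) \<le> vsob_norm s U"
  using sob_norm_nonneg by (cases \<sigma>) (auto simp: vsob_norm_def intro!: real_le_rsqrt)

lemma couple_in_sball: "couple u \<in> sball s r \<longleftrightarrow> sob s u \<and> sqrt 2 * sob_norm s u < r"
  by (simp add: sball_def vsob_norm_couple)

lemma sum_fun_apply: "(\<Sum>i\<in>A. f i) x = (\<Sum>i\<in>A. f i x)"
  by (induction A rule: infinite_finite_induct) auto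

lemma gain_Nil:
  assumes "p \<ge> 1"
  shows "gain p s0 H U [] = real p * vsob_norm s0 U ^ (p - 1) * H U"
  by (simp add: gain_def)

text \<open>Strong induction on the order: once the lower coefficients vanish, dividing by
  \<epsilon>^q and letting \<epsilon> tend to 0 from the right isolates the coefficient of order
  q.\<close>

lemma polynomial_coeffs_zero:
  fixes c :: "nat \<Rightarrow> real"
  assumes "\<epsilon>0 > 0" "\<And>\<epsilon>. 0 < \<epsilon> \<Longrightarrow> \<epsilon> < \<epsilon>0 \<Longrightarrow> \<bar>\<Sum>q\<in>{p..<N}. c q * \<epsilon> ^ q\<bar> \<le> C * \<epsilon> ^ N"
    and "q \<in> {p..<N}"
  shows "c q = 0"
  using assms(3)
proof (induction q rule: less_induct)
  case (less q)
  have q: "p \<le> q" "q < N" using less.prems by auto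
  have pos: "eventually (\<lambda>\<epsilon>::real. 0 < \<epsilon> \<and> \<epsilon> < \<epsilon>0) (at_right 0)"
    using eventually_at_right_real[OF assms(1)] by simp
  have eq: "(\<Sum>j\<in>{p..<N}. c j * \<epsilon> ^ j) = \<epsilon> ^ q * (\<Sum>j\<in>{q..<N}. c j * \<epsilon> ^ (j - q))" for \<epsilon> :: real
  proof -
    have "(\<Sum>j\<in>{p..<N}. c j * \<epsilon> ^ j) = (\<Sum>j\<in>{q..<N}. c j * \<epsilon> ^ j)"
      using less.IH q by (intro sum.mono_neutral_right) auto
    also have "\<dots> = (\<Sum>j\<in>{q..<N}. \<epsilon> ^ q * (c j * \<epsilon> ^ (j - q)))"
      by (intro sum.cong) (auto simp flip: power_add)
    finally show ?thesis by (simp add: sum_distrib_left)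
  qed
  have le: "\<bar>\<Sum>j\<in>{q..<N}. c j * \<epsilon> ^ (j - q)\<bar> \<le> C * \<epsilon> ^ (N - q)" if "0 < \<epsilon>" "\<epsilon> < \<epsilon>0" for \<epsilon>
  proof -
    let ?S = "\<Sum>j\<in>{q..<N}. c j * \<epsilon> ^ (j - q)"
    have "C * \<epsilon> ^ N = \<epsilon> ^ q * (C * \<epsilon> ^ (N - q))"
      using q by (simp flip: power_add)
    then have "\<bar>\<epsilon> ^ q * ?S\<bar> \<le> \<epsilon> ^ q * (C * \<epsilon> ^ (N - q))"
      using assms(2)[OF that] unfolding eq by (simp only:)
    moreover have "\<bar>\<epsilon> ^ q * ?S\<bar> = \<epsilon> ^ q * \<bar>?S\<bar>"
      using that by (simp add: abs_mult)
    ultimately have "\<epsilon> ^ q * \<bar>?S\<bar> \<le> \<epsilon> ^ q * (C * \<epsilon> ^ (N - q))"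
      by (simp only:)
    then show ?thesis by (rule mult_left_le_imp_le) (use that in simp)
  qed
  have l0: "((\<lambda>\<epsilon>. \<Sum>j\<in>{q..<N}. c j * \<epsilon> ^ (j - q)) \<longlongrightarrow> 0) (at_right 0)"
  proof (rule Lim_null_comparison[OF eventually_mono[OF pos]])
    have "((\<lambda>\<epsilon>. C * \<epsilon> ^ (N - q)) \<longlongrightarrow> C * 0 ^ (N - q)) (at_right 0)"
      by (intro tendsto_intros)
    \<comment> \<open>The exponent N - q is positive, so the bound tends to 0.\<close>
    then show "((\<lambda>\<epsilon>. C * \<epsilon> ^ (N - q)) \<longlongrightarrow> 0) (at_right 0)"
      using q by (simp add: power_0_left)
  qed (use le in auto)
  have l1: "((\<lambda>\<epsilon>. \<Sum>j\<in>{q..<N}. c j * \<epsilon> ^ (j - q)) \<longlongrightarrow> (\<Sum>j\<in>{q..<N}. c j * 0 ^ (j - q))) (at_right 0)"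
    by (intro tendsto_intros)
  \<comment> \<open>Since 0 ^ 0 = 1, exactly the term j = q survives at \<epsilon> = 0.\<close>
  have "(\<Sum>j\<in>{q..<N}. c j * 0 ^ (j - q)) = (\<Sum>j\<in>{q}. c j * 0 ^ (j - q))"
    using q by (intro sum.mono_neutral_right) auto
  then show ?case using tendsto_unique[OF trivial_limit_at_right_real l1 l0] by simp
qed

section \<open>Phase rotations and resonant terms\<close>

text \<open>This is the factor that \<open>coef \<sigma> j\<close> acquires under the flow of the
  super action J_n; conjugate coefficients receive the inverse phase.\<close>

definition phase :: "real \<Rightarrow> nat \<Rightarrow> sign \<Rightarrow> int \<Rightarrow> complex" where
  "phase \<theta> n \<sigma> j = (if nat \<bar>j\<bar> = n then cis (of_int (sg \<sigma>) * \<theta>) else 1)"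

text \<open>Scaling and rotation are combined in one map: the power of \<epsilon> records the degree
  of a term, while \<theta> moves along the orbit.\<close>

definition rot :: "real \<Rightarrow> real \<Rightarrow> nat \<Rightarrow> fn \<Rightarrow> fn" where
  "rot \<epsilon> \<theta> n u = (\<lambda>k. of_real \<epsilon> * phase \<theta> n Pl k * u k)"

lemma phase_abs_cong: "\<bar>j\<bar> = \<bar>j'\<bar> \<Longrightarrow> phase \<theta> n \<sigma> j = phase \<theta> n \<sigma> j'"
  by (simp add: phase_def)

lemma phase_opp_mult: "phase \<theta> n (opp \<sigma>) j * phase \<theta> n \<sigma> j = 1"
  by (cases \<sigma>) (simp_all add: phase_def cis_mult)

lemma norm_phase [simp]: "cmod (phase \<theta> n \<sigma> j) = 1"
  by (simp add: phase_def)

lemma cnj_phase: "cnj (phase \<theta> n \<sigma> j) = phase \<theta> n (opp \<sigma>) j"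
  by (cases \<sigma>) (simp_all add: phase_def cis_cnj)

text \<open>Resonance pairs the indices so that partners have opposite signs and equal moduli; the
  phases of two partners are inverse to each other.\<close>

lemma prod_phase_resonant:
  assumes "(\<sigma>s, js) \<in> resonant q"
  shows "(\<Prod>i<q. phase \<theta> n (\<sigma>s ! i) (js ! i)) = 1"
proof -
  define g where "g i = phase \<theta> n (\<sigma>s ! i) (js ! i)" for i
  obtain \<pi> where "even q" and \<pi>: "\<pi> permutes {..<q}"
    and pair: "\<And>i. i < q div 2 \<Longrightarrow>
      \<sigma>s ! \<pi> i = opp (\<sigma>s ! \<pi> (q div 2 + i)) \<and> \<bar>js ! \<pi> i\<bar> = \<bar>js ! \<pi> (q div 2 + i)\<bar>"
    using assms by (auto simp: resonant_def)
  then obtain h where h: "q = h + h" by (metis evenE mult_2)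
  have split: "(\<Prod>i<h + l. f i) = (\<Prod>i<h. f i) * (\<Prod>i<l. f (h + i))" for l and f :: "nat \<Rightarrow> complex"
    by (induction l) (simp_all add: mult.assoc)
  \<comment> \<open>The product is reordered by the pairing permutation, and its two halves are then
    multiplied factor by factor.\<close>
  have "(\<Prod>i<q. g i) = (\<Prod>i<q. g (\<pi> i))"
    using prod.permute[OF \<pi>, of g] by (simp add: o_def)
  also have "\<dots> = (\<Prod>i<h. g (\<pi> i)) * (\<Prod>i<h. g (\<pi> (h + i)))"
    unfolding h by (rule split)
  also have "\<dots> = (\<Prod>i<h. g (\<pi> i) * g (\<pi> (h + i)))"
    by (simp add: prod.distrib)
  also have "\<dots> = 1"
  proof (rule prod.neutral, rule ballI)
    fix i assume "i \<in> {..<h}"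
    then have "\<sigma>s ! \<pi> i = opp (\<sigma>s ! \<pi> (h + i))" "\<bar>js ! \<pi> i\<bar> = \<bar>js ! \<pi> (h + i)\<bar>"
      using pair[of i] h by auto
    then show "g (\<pi> i) * g (\<pi> (h + i)) = 1"
      unfolding g_def by (metis phase_abs_cong phase_opp_mult)
  qed
  finally show ?thesis by (simp add: g_def)
qed

lemma coef_rot:
  "coef \<sigma> j (couple (rot \<epsilon> \<theta> n u)) = of_real \<epsilon> * phase \<theta> n \<sigma> j * coef \<sigma> j (couple u)"
  by (cases \<sigma>) (simp_all add: coef_def rot_def fconj_def cnj_phase)

lemma coef_vproj_rot:
  "coef \<sigma> j (vproj l (couple (rot \<epsilon> \<theta> n u))) = of_real \<epsilon> * phase \<theta> n \<sigma> j * coef \<sigma> j (vproj l (couple u))"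
  using coef_rot[of \<sigma> j \<epsilon> \<theta> n u] by (simp add: coef_def vproj_def proj_def)

lemma couple_rot_apply:
  "couple (rot \<epsilon> \<theta> n u) \<sigma> (sg \<sigma> * j) = of_real \<epsilon> * phase \<theta> n \<sigma> j * couple u \<sigma> (sg \<sigma> * j)"
  using coef_rot by (simp add: coef_def)

text \<open>The resonance condition includes the output index with reversed sign. Hence the phases
  of all inputs multiply to the phase of the output. The q inner arguments and the outer one give q
  + 1 powers of \<epsilon>.\<close>

lemma res_hop_rot:
  "res_hop Pl \<sigma>' q R (replicate q (couple (rot \<epsilon> \<theta> n u))) (couple (rot \<epsilon> \<theta> n u) \<sigma>') k
   = of_real \<epsilon> ^ (q + 1) * phase \<theta> n Pl k * res_hop Pl \<sigma>' q R (replicate q (couple u)) (couple u \<sigma>') k"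
proof -
  have key: "(\<Prod>i<q. phase \<theta> n (\<sigma>s ! i) (js ! i)) * phase \<theta> n \<sigma>' j = phase \<theta> n Pl k"
    if "(\<sigma>s @ [opp Pl, \<sigma>'], js @ [k, j]) \<in> resonant (q + 2)" "length \<sigma>s = q" "length js = q" for \<sigma>s js j
  proof -
    let ?P = "\<Prod>i<q. phase \<theta> n (\<sigma>s ! i) (js ! i)"
    have "?P * phase \<theta> n Mi k * phase \<theta> n \<sigma>' j = 1"
      using prod_phase_resonant[OF that(1), of \<theta> n] that(2,3) by (simp add: nth_append numeral_2_eq_2)
    then have "?P * phase \<theta> n \<sigma>' j * (phase \<theta> n (opp Pl) k * phase \<theta> n Pl k) = phase \<theta> n Pl k"
      by (simp add: algebra_simps)
    then show ?thesis by (simp only: phase_opp_mult mult_1_right)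
  qed
  have "res_hop_coef Pl \<sigma>' q R (replicate q (couple (rot \<epsilon> \<theta> n u))) k j * phase \<theta> n \<sigma>' j
      = of_real \<epsilon> ^ q * phase \<theta> n Pl k * res_hop_coef Pl \<sigma>' q R (replicate q (couple u)) k j" for j
  proof -
    have "phase \<theta> n \<sigma>' j * (\<Prod>i<q. coef (\<sigma>s ! i) (js ! i) (couple (rot \<epsilon> \<theta> n u)))
        = of_real \<epsilon> ^ q * phase \<theta> n Pl k * (\<Prod>i<q. coef (\<sigma>s ! i) (js ! i) (couple u))"
      if "(\<sigma>s @ [opp Pl, \<sigma>'], js @ [k, j]) \<in> resonant (q + 2)" "length \<sigma>s = q" "length js = q" for \<sigma>s js
      unfolding coef_rot prod.distrib using key[OF that] by (simp add: algebra_simps)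
    then show ?thesis
      unfolding res_hop_coef_def infsum_cmult_right'[symmetric] mult.commute[of _ "phase \<theta> n \<sigma>' j"]
      by (intro infsum_cong) (auto simp: algebra_simps)
  qed
  then show ?thesis
    unfolding res_hop_def couple_rot_apply infsum_cmult_right'[symmetric]
    by (intro infsum_cong) (auto simp: algebra_simps)
qed

text \<open>A symbol has no output index, so here the phases cancel completely and only the scaling
  remains. Projections do no harm, since they act diagonally on the coefficients.\<close>

lemma res_hsym_rot:
  assumes "length ns = q"
  shows "res_hsym q a (vprojs ns (replicate q (couple (rot \<epsilon> \<theta> n u)))) x \<xi>
    = of_real \<epsilon> ^ q * res_hsym q a (vprojs ns (replicate q (couple u))) x \<xi>"
proof -
  have "(\<Prod>i<q. coef (\<sigma>s ! i) (js ! i) (vprojs ns (replicate q (couple (rot \<epsilon> \<theta> n u))) ! i))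
      = of_real \<epsilon> ^ q * (\<Prod>i<q. coef (\<sigma>s ! i) (js ! i) (vprojs ns (replicate q (couple u)) ! i))"
    if "(\<sigma>s, js) \<in> resonant q" for \<sigma>s js
  proof -
    have "(\<Prod>i<q. coef (\<sigma>s ! i) (js ! i) (vprojs ns (replicate q (couple (rot \<epsilon> \<theta> n u))) ! i))
      = (\<Prod>i<q. of_real \<epsilon> * phase \<theta> n (\<sigma>s ! i) (js ! i)
           * coef (\<sigma>s ! i) (js ! i) (vprojs ns (replicate q (couple u)) ! i))"
      using assms by (intro prod.cong) (auto simp: vprojs_def coef_vproj_rot)
    then show ?thesis by (simp add: prod.distrib prod_phase_resonant[OF that])
  qed
  then show ?thesis
    unfolding res_hsym_def infsum_cmult_right'[symmetric]
    by (intro infsum_cong) (auto simp: algebra_simps)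
qed

section \<open>Quantization of symbols independent of x\<close>

lemma fourier_scale: "fourier (\<lambda>x. c * f x) n = c * fourier f n"
  by (simp add: fourier_def mult.assoc)

lemma hom_trunc_rot:
  "hom_trunc Y q (res_hsym q a) (replicate q (couple (rot \<epsilon> \<theta> n u))) \<eta> \<xi>
   = of_real \<epsilon> ^ q * hom_trunc Y q (res_hsym q a) (replicate q (couple u)) \<eta> \<xi>"
proof -
  have "(\<Sum>\<^sub>\<infinity>ns\<in>{ns. length ns = q}. of_real (Y (map real ns) \<xi>)
           * res_hsym q a (vprojs ns (replicate q (couple (rot \<epsilon> \<theta> n u)))) x \<xi>)
      = of_real \<epsilon> ^ q * (\<Sum>\<^sub>\<infinity>ns\<in>{ns. length ns = q}. of_real (Y (map real ns) \<xi>)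
           * res_hsym q a (vprojs ns (replicate q (couple u))) x \<xi>)" for x
    unfolding infsum_cmult_right'[symmetric] by (intro infsum_cong) (auto simp: res_hsym_rot)
  then show ?thesis unfolding hom_trunc_def by (simp add: fourier_scale)
qed

lemma integral_exp_nonzero_mode:
  assumes "n \<noteq> (0 :: int)"
  shows "integral {0..2 * pi} (\<lambda>x. exp (- \<i> * of_int n * of_real x)) = 0"
proof -
  let ?F = "\<lambda>x::real. exp (- \<i> * of_int n * of_real x) / (- \<i> * of_int n)"
  have "((\<lambda>x. exp (- \<i> * of_int n * of_real x)) has_integral (?F (2 * pi) - ?F 0)) {0..2 * pi}"
  proof (rule fundamental_theorem_of_calculus)
    fix x :: real
    have "((\<lambda>z. exp (- \<i> * of_int n * z) / (- \<i> * of_int n)) has_field_derivative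
        exp (- \<i> * of_int n * of_real x)) (at (of_real x))"
      using assms by (auto intro!: derivative_eq_intros)
    then show "(?F has_vector_derivative exp (- \<i> * of_int n * of_real x)) (at x within {0..2 * pi})"
      by (rule has_vector_derivative_real_field)
  qed simp
  moreover have "exp (- \<i> * of_int n * of_real (2 * pi)) = 1"
    using exp_integer_2pi[of "of_int (- n)"] by (simp add: algebra_simps)
  ultimately have "((\<lambda>x. exp (- \<i> * of_int n * of_real x)) has_integral 0) {0..2 * pi}"
    by (simp only: of_real_0 mult_zero_right exp_zero diff_self)
  then show ?thesis by (rule integral_unique)
qed

lemma fourier_const: "fourier (\<lambda>x. c) n = (if n = 0 then c * of_real (sqrt (2 * pi)) else 0)"
proof (cases "n = 0")
  case True
  have "of_real (2 * pi) / of_real (sqrt (2 * pi)) = (of_real (sqrt (2 * pi)) :: complex)"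
    unfolding of_real_divide[symmetric] by (subst real_div_sqrt) auto
  moreover have "fourier (\<lambda>x. c) n = c * (of_real (2 * pi) / of_real (sqrt (2 * pi)))"
    using True by (simp add: fourier_def scaleR_conv_of_real)
  ultimately show ?thesis using True by (simp only: simp_thms if_True)
qed (use integral_exp_nonzero_mode[of n] in \<open>simp add: fourier_def\<close>)

text \<open>When only the zero x-frequency is present, input and output modes coincide, the midpoint
  in the Weyl formula is the mode itself, and the operator is a Fourier multiplier.\<close>

lemma weyl_diagonal:
  assumes "\<And>\<eta> \<xi>. \<eta> \<noteq> 0 \<Longrightarrow> b \<eta> \<xi> = 0"
  shows "weyl b v k = b 0 (of_int k) * v k / of_real (sqrt (2 * pi))"
proof -
  have "(\<Sum>\<^sub>\<infinity>j. b (k - j) (of_int (k + j) / 2) * v j)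
      = (\<Sum>\<^sub>\<infinity>j\<in>{k}. b (k - j) (of_int (k + j) / 2) * v j)"
    using assms by (intro infsum_cong_neutral) auto
  then show ?thesis by (simp add: weyl_def)
qed

lemma vbasis_smooth: "vbasis \<sigma> j \<in> smooth_vecs"
  unfolding smooth_vecs_def vsob_def
  by (auto simp: vbasis_def fbasis_def split: if_splits intro!: sob_finite_support[of "{sg \<sigma> * j}"])

text \<open>Independence of x is assumed on smooth arguments; the resonant part evaluates the symbol
  only on basis vectors, which are smooth.\<close>

lemma res_hsym_x_independent:
  assumes "\<And>Us x y \<xi>. length Us = q \<Longrightarrow> set Us \<subseteq> smooth_vecs \<Longrightarrow> a Us x \<xi> = a Us y \<xi>"
  shows "res_hsym q a Us x \<xi> = res_hsym q a Us y \<xi>"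
proof -
  have "a (map2 vbasis \<sigma>s js) x \<xi> = a (map2 vbasis \<sigma>s js) y \<xi>" if "(\<sigma>s, js) \<in> resonant q" for \<sigma>s js
    using that by (intro assms) (auto simp: resonant_def vbasis_smooth)
  then show ?thesis unfolding res_hsym_def by (intro infsum_cong) auto
qed

lemma hom_trunc_res_hsym_off_diagonal:
  assumes "\<And>Us x y \<xi>. length Us = q \<Longrightarrow> set Us \<subseteq> smooth_vecs \<Longrightarrow> a Us x \<xi> = a Us y \<xi>" "\<eta> \<noteq> 0"
  shows "hom_trunc Y q (res_hsym q a) Us \<eta> \<xi> = 0"
proof -
  have "(\<lambda>x. \<Sum>\<^sub>\<infinity>ns\<in>{ns. length ns = q}. of_real (Y (map real ns) \<xi>) * res_hsym q a (vprojs ns Us) x \<xi>)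
      = (\<lambda>x. \<Sum>\<^sub>\<infinity>ns\<in>{ns. length ns = q}. of_real (Y (map real ns) \<xi>) * res_hsym q a (vprojs ns Us) 0 \<xi>)"
    using res_hsym_x_independent[where a = a and q = q, OF assms(1)] by (intro ext infsum_cong) metis
  then show ?thesis unfolding hom_trunc_def using assms(2) by (simp add: fourier_const)
qed

text \<open>The multiplier is invariant under rotation and homogeneous of degree q; the phase and
  one more power of \<epsilon> come from the function it acts on.\<close>

lemma weyl_hom_rot:
  assumes "\<And>Us x y \<xi>. length Us = q \<Longrightarrow> set Us \<subseteq> smooth_vecs \<Longrightarrow> a Us x \<xi> = a Us y \<xi>"
  shows "weyl (hom_trunc Y q (res_hsym q a) (replicate q (couple (rot \<epsilon> \<theta> n u)))) (rot \<epsilon> \<theta> n u) k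
    = of_real \<epsilon> ^ (q + 1) * phase \<theta> n Pl k * weyl (hom_trunc Y q (res_hsym q a) (replicate q (couple u))) u k"
proof -
  have off: "hom_trunc Y q (res_hsym q a) Us \<eta> \<xi> = 0" if "\<eta> \<noteq> 0" for Us \<eta> \<xi>
    using assms that by (rule hom_trunc_res_hsym_off_diagonal)
  have "rot \<epsilon> \<theta> n u k = of_real \<epsilon> * phase \<theta> n Pl k * u k"
    by (simp add: rot_def)
  then show ?thesis
    by (simp add: weyl_diagonal[OF off] hom_trunc_rot[of Y q a])
qed

text \<open>The factor sqrt (2 pi) in the Fourier coefficient of a constant cancels the
  normalization of \<open>weyl\<close>; the cut-off at zero frequency stays as a real
  factor.\<close>

lemma weyl_nonhom_diagonal:
  assumes "\<And>x y \<xi>. a U x \<xi> = a U y \<xi>"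
  shows "weyl (nonhom_trunc Y a U) v k = of_real (Y [0] (of_int k)) * a U 0 (of_int k) * v k"
proof -
  have "nonhom_trunc Y a U \<eta> \<xi> =
      of_real (Y [of_int \<eta>] \<xi>) * (if \<eta> = 0 then a U 0 \<xi> * of_real (sqrt (2 * pi)) else 0)" for \<eta> \<xi>
  proof -
    have "(\<lambda>x. a U x \<xi>) = (\<lambda>x. a U 0 \<xi>)" using assms by blast
    then show ?thesis by (simp add: nonhom_trunc_def fourier_const)
  qed
  then show ?thesis by (subst weyl_diagonal) auto
qed

section \<open>Gradients and orbits of the super actions\<close>

lemma pairing_couple_finite_support:
  assumes "finite K" "\<And>k. k \<notin> K \<Longrightarrow> h k = 0"
  shows "pairing G (couple h) = (\<Sum>k\<in>K. G Pl (- k) * h k + G Mi k * cnj (h k))"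
proof -
  \<comment> \<open>Reflecting the summation index moves the minus sign from the direction h to the
    gradient.\<close>
  have "(\<Sum>\<^sub>\<infinity>n. G Pl n * h (- n)) = (\<Sum>\<^sub>\<infinity>k. G Pl (- k) * h k)"
    using infsum_reindex_bij_betw[OF bij_uminus, of "\<lambda>n. G Pl n * h (- n)"] by simp
  also have "\<dots> = (\<Sum>\<^sub>\<infinity>k\<in>K. G Pl (- k) * h k)"
    using assms by (intro infsum_cong_neutral) auto
  finally have "(\<Sum>\<^sub>\<infinity>n. G Pl n * h (- n)) = (\<Sum>k\<in>K. G Pl (- k) * h k)"
    using assms by simp
  moreover have "(\<Sum>\<^sub>\<infinity>n. G Mi n * cnj (h n)) = (\<Sum>\<^sub>\<infinity>n\<in>K. G Mi n * cnj (h n))"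
    using assms by (intro infsum_cong_neutral) auto
  ultimately show ?thesis
    using assms by (simp add: pairing_def fconj_def sum.distrib)
qed

text \<open>As H is real valued, its differential is real in every single-mode direction with
  coefficient c. The choices c = 1 and c = \<i> give the imaginary and the real part of the
  identity.\<close>

lemma gradient_reality:
  assumes "has_gradient s H G u"
  shows "G Pl (- k) = cnj (G Mi k)"
proof -
  have Im0: "Im (G Pl (- k) * c + G Mi k * cnj c) = 0" for c
  proof -
    define z where "z = G Pl (- k) * c + G Mi k * cnj c"
    define B where "B = jap (of_int k) powr s * cmod c"
    have "\<bar>Im z\<bar> \<le> 0 + \<epsilon>" if "\<epsilon> > 0" for \<epsilon>
    proof -
      have B: "0 \<le> B" by (simp add: B_def)
      \<comment> \<open>B vanishes when c does, so the denominators use B + 1.\<close>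
      define e where "e = \<epsilon> / (B + 1)"
      have e: "e > 0" using that B by (simp add: e_def)
      then obtain \<delta> where "\<delta> > 0" and \<delta>: "\<And>h. sob s h \<Longrightarrow> sob_norm s h < \<delta> \<Longrightarrow>
        cmod (of_real (H (couple (u + h)) - H (couple u)) - pairing G (couple h)) \<le> e * sob_norm s h"
        using assms unfolding has_gradient_def by blast
      \<comment> \<open>This step size gives t B < \<delta>, so the increment h lies where the
        gradient estimate holds.\<close>
      define t where "t = \<delta> / (B + 1) / 2"
      have "0 < B * \<delta> + \<delta> * 2" using \<open>\<delta> > 0\<close> B by (intro add_nonneg_pos mult_nonneg_nonneg) auto
      then have t: "t > 0" "t * B < \<delta>" using \<open>\<delta> > 0\<close> B by (auto simp: t_def field_simps)
      define h where "h = (\<lambda>n. if n = k then of_real t * c else 0)"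
      have sup: "\<And>n. n \<notin> {k} \<Longrightarrow> h n = 0" by (simp add: h_def)
      have n: "sob_norm s h \<le> t * B"
        using sob_norm_finite_support[of "{k}" h s] sup t by (simp add: h_def B_def norm_mult mult.left_commute)
      have p: "pairing G (couple h) = of_real t * z"
        by (subst pairing_couple_finite_support[of "{k}"]) (auto simp: h_def z_def algebra_simps)
      \<comment> \<open>The increment of H is real, so only the pairing contributes to the imaginary
        part.\<close>
      have "\<bar>t * Im z\<bar> = \<bar>Im (of_real (H (couple (u + h)) - H (couple u)) - pairing G (couple h))\<bar>"
        by (simp add: p)
      also have "\<dots> \<le> cmod (of_real (H (couple (u + h)) - H (couple u)) - pairing G (couple h))"
        by (rule abs_Im_le_cmod)
      also have "\<dots> \<le> e * sob_norm s h"
      proof (rule \<delta>)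
        show "sob s h" by (rule sob_finite_support[of "{k}"]) (use sup in auto)
        show "sob_norm s h < \<delta>" using n t by linarith
      qed
      also have "\<dots> \<le> e * (t * B)" using n e by simp
      finally have "\<bar>t * Im z\<bar> \<le> e * (t * B)" .
      then have "t * \<bar>Im z\<bar> \<le> t * (e * B)" using t by (simp add: abs_mult algebra_simps)
      then have "\<bar>Im z\<bar> \<le> e * B" using t(1) by simp
      also have "\<dots> \<le> \<epsilon>" using that B by (simp add: e_def field_simps)
      finally show ?thesis by simp
    qed
    then show ?thesis using field_le_epsilon[of "\<bar>Im z\<bar>" 0] by (simp add: z_def)
  qed
  show ?thesis
    using Im0[of 1] Im0[of \<i>] by (simp add: complex_eq_iff)
qed

lemma has_vector_derivative_iff_quotient:
  fixes f :: "real \<Rightarrow> complex"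
  shows "(f has_vector_derivative D) (at x within S) \<longleftrightarrow>
    ((\<lambda>y. (f y - f x) / of_real (y - x)) \<longlongrightarrow> D) (at x within S)"
proof -
  have "norm ((f y - f x) - (y - x) *\<^sub>R D) / norm (y - x) = norm ((f y - f x) / of_real (y - x) - D)"
    if "y \<noteq> x" for y
  proof -
    have "(f y - f x) / of_real (y - x) - D = ((f y - f x) - (y - x) *\<^sub>R D) / of_real (y - x)"
      using that by (simp add: diff_divide_distrib scaleR_conv_of_real flip: of_real_diff)
    then show ?thesis by (simp only: norm_divide norm_of_real real_norm_def)
  qed
  then have "((\<lambda>y. norm ((f y - f x) - (y - x) *\<^sub>R D) / norm (y - x)) \<longlongrightarrow> 0) (at x within S) \<longleftrightarrow>
      ((\<lambda>y. norm ((f y - f x) / of_real (y - x) - D)) \<longlongrightarrow> 0) (at x within S)"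
    by (intro filterlim_cong refl) (auto simp: eventually_at_filter)
  then show ?thesis
    unfolding has_vector_derivative_def has_derivative_iff_norm tendsto_norm_zero_iff LIM_zero_iff
    by (simp add: bounded_linear_scaleR_left)
qed

text \<open>The curve moves only finitely many modes, so its increments are trigonometric
  polynomials: they lie in every Sobolev space and their pairing with the gradient is a finite
  sum.\<close>

lemma has_gradient_chain:
  assumes G: "has_gradient s H G (\<gamma> t)" and K: "finite K"
    and const: "\<And>\<tau> k. k \<notin> K \<Longrightarrow> \<gamma> \<tau> k = \<gamma> t k"
    and deriv: "\<And>k. k \<in> K \<Longrightarrow> ((\<lambda>\<tau>. \<gamma> \<tau> k) has_vector_derivative g k) (at t)"
  shows "((\<lambda>\<tau>. H (couple (\<gamma> \<tau>))) has_real_derivative 2 * Re (\<Sum>k\<in>K. G Mi k * cnj (g k))) (at t)"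
proof -
  \<comment> \<open>\<open>d\<close> and \<open>E\<close> are the difference quotients of the curve
    and of H, \<open>P\<close> is the differential of H applied to \<open>d\<close>, and
    \<open>L\<close> dominates the Sobolev norm of \<open>d\<close>.\<close>
  define d where "d \<tau> k = (\<gamma> \<tau> k - \<gamma> t k) / of_real (\<tau> - t)" for \<tau> k
  define E where "E \<tau> = (H (couple (\<gamma> \<tau>)) - H (couple (\<gamma> t))) / (\<tau> - t)" for \<tau>
  define P where "P \<tau> = (\<Sum>k\<in>K. cnj (G Mi k) * d \<tau> k + G Mi k * cnj (d \<tau> k))" for \<tau>
  define L where "L \<tau> = (\<Sum>k\<in>K. jap (of_int k) powr s * cmod (d \<tau> k))" for \<tau>
  have d_lim: "((\<lambda>\<tau>. d \<tau> k) \<longlongrightarrow> g k) (at t)" if "k \<in> K" for k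
    using deriv[OF that] unfolding has_vector_derivative_iff_quotient d_def .
  have L_lim: "(L \<longlongrightarrow> (\<Sum>k\<in>K. jap (of_int k) powr s * cmod (g k))) (at t)"
    unfolding L_def by (intro tendsto_intros d_lim)
  have P_lim: "(P \<longlongrightarrow> (\<Sum>k\<in>K. cnj (G Mi k) * g k + G Mi k * cnj (g k))) (at t)"
    unfolding P_def by (intro tendsto_intros d_lim)
  \<comment> \<open>Adding 1 makes B positive and strictly larger than the limit of
    \<open>L\<close>.\<close>
  define B where "B = (\<Sum>k\<in>K. jap (of_int k) powr s * cmod (g k)) + 1"
  have B: "B > 0" unfolding B_def by (intro add_nonneg_pos sum_nonneg) auto
  have L_B: "\<forall>\<^sub>F \<tau> in at t. L \<tau> < B"
    using L_lim by (rule order_tendstoD) (simp add: B_def)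
  have "\<forall>\<^sub>F \<tau> in at t. cmod (of_real (E \<tau>) - P \<tau>) < e" if "e > 0" for e
  proof -
    \<comment> \<open>The factor 2 makes e' B strictly smaller than e.\<close>
    define e' where "e' = e / (2 * B)"
    have e': "e' > 0" "e' * B < e" using that B by (auto simp: e'_def)
    obtain \<delta> where "\<delta> > 0" and \<delta>: "\<And>h. sob s h \<Longrightarrow> sob_norm s h < \<delta> \<Longrightarrow>
        cmod (of_real (H (couple (\<gamma> t + h)) - H (couple (\<gamma> t))) - pairing G (couple h)) \<le> e' * sob_norm s h"
      using G e'(1) unfolding has_gradient_def by blast
    have "\<forall>\<^sub>F \<tau> in at t. \<bar>\<tau> - t\<bar> < \<delta> / B \<and> \<tau> \<noteq> t"
      using \<open>\<delta> > 0\<close> B unfolding eventually_at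
      by (intro exI[of _ "\<delta> / B"]) (auto simp: dist_real_def)
    with L_B show ?thesis
    proof eventually_elim
      case (elim \<tau>)
      define h where "h = \<gamma> \<tau> - \<gamma> t"
      have sup: "\<And>k. k \<notin> K \<Longrightarrow> h k = 0" by (simp add: h_def const[of _ \<tau>])
      have hd: "h k = of_real (\<tau> - t) * d \<tau> k" for k using elim by (simp add: h_def d_def)
      have "sob_norm s h \<le> \<bar>\<tau> - t\<bar> * L \<tau>"
        using sob_norm_finite_support[of K h s, OF K sup] unfolding L_def hd
        by (simp add: norm_mult sum_distrib_left algebra_simps flip: of_real_diff)
      also have "\<dots> \<le> \<bar>\<tau> - t\<bar> * B" using elim by (intro mult_left_mono) auto
      finally have n: "sob_norm s h \<le> \<bar>\<tau> - t\<bar> * B" .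
      have less: "\<bar>\<tau> - t\<bar> * B < \<delta>" using elim B by (simp add: field_simps)
      have "cmod (of_real (H (couple (\<gamma> t + h)) - H (couple (\<gamma> t))) - pairing G (couple h)) \<le> e' * sob_norm s h"
        using n less sob_finite_support[of K h s, OF K sup] by (intro \<delta>) auto
      also have "\<dots> \<le> e' * (\<bar>\<tau> - t\<bar> * B)" using n e'(1) by simp
      finally have "cmod (of_real (H (couple (\<gamma> t + h)) - H (couple (\<gamma> t))) - pairing G (couple h)) \<le> e' * (\<bar>\<tau> - t\<bar> * B)" .
      moreover have "\<gamma> t + h = \<gamma> \<tau>" by (simp add: h_def)
      moreover have "pairing G (couple h) = of_real (\<tau> - t) * P \<tau>"
        by (subst pairing_couple_finite_support[of K h, OF K sup])
          (simp_all add: P_def hd gradient_reality[OF G] sum_distrib_left algebra_simps)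
      moreover have "H (couple (\<gamma> \<tau>)) - H (couple (\<gamma> t)) = (\<tau> - t) * E \<tau>" using elim by (simp add: E_def)
      ultimately have "cmod (of_real (\<tau> - t) * (of_real (E \<tau>) - P \<tau>)) \<le> e' * (\<bar>\<tau> - t\<bar> * B)"
        by (simp add: right_diff_distrib)
      then have "\<bar>\<tau> - t\<bar> * cmod (of_real (E \<tau>) - P \<tau>) \<le> \<bar>\<tau> - t\<bar> * (e' * B)"
        by (simp only: norm_mult norm_of_real mult.left_commute)
      then have "cmod (of_real (E \<tau>) - P \<tau>) \<le> e' * B" using elim by simp
      then show ?case using e' by linarith
    qed
  qed
  then have "((\<lambda>\<tau>. of_real (E \<tau>) - P \<tau>) \<longlongrightarrow> 0) (at t)"
    by (simp add: tendsto_iff)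
  from tendsto_add[OF this P_lim]
  have "((\<lambda>\<tau>. of_real (E \<tau>)) \<longlongrightarrow> (\<Sum>k\<in>K. cnj (G Mi k) * g k + G Mi k * cnj (g k))) (at t)"
    by simp
  from tendsto_Re[OF this] have "(E \<longlongrightarrow> Re (\<Sum>k\<in>K. cnj (G Mi k) * g k + G Mi k * cnj (g k))) (at t)"
    by simp
  \<comment> \<open>The two summands are conjugate to each other, which doubles the real
    part.\<close>
  also have "Re (\<Sum>k\<in>K. cnj (G Mi k) * g k + G Mi k * cnj (g k)) = 2 * Re (\<Sum>k\<in>K. G Mi k * cnj (g k))"
    by (simp add: sum_distrib_left mult.commute flip: sum.distrib)
  finally show ?thesis
    unfolding E_def has_field_derivative_iff by simp
qed

section \<open>Closed orbits of the super actions\<close>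

lemma finite_modes [simp]: "finite {k :: int. nat \<bar>k\<bar> = n}"
  by (rule finite_subset[of _ "{- int n..int n}"]) auto

lemma rot_period: "rot \<epsilon> (2 * pi) n u = rot \<epsilon> 0 n u"
  by (simp add: rot_def phase_def fun_eq_iff)

lemma rot_has_vector_derivative:
  "((\<lambda>\<theta>. rot \<epsilon> \<theta> n u k) has_vector_derivative (if nat \<bar>k\<bar> = n then \<i> * rot \<epsilon> \<theta> n u k else 0)) (at \<theta>)"
proof -
  have "(cis has_vector_derivative \<i> * cis \<theta>) (at \<theta>)"
    unfolding has_vector_derivative_complex_iff by (auto intro!: derivative_eq_intros)
  from has_vector_derivative_mult_right[OF has_vector_derivative_mult_left[OF this, of "u k"], of "of_real \<epsilon>"]
  have "((\<lambda>\<theta>. of_real \<epsilon> * cis \<theta> * u k) has_vector_derivative \<i> * (of_real \<epsilon> * cis \<theta> * u k)) (at \<theta>)"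
    by (simp add: algebra_simps)
  then show ?thesis by (simp add: rot_def phase_def)
qed

lemma
  assumes "sob s u"
  shows sob_rot: "sob s (rot \<epsilon> \<theta> n u)" and sob_norm_rot: "sob_norm s (rot \<epsilon> \<theta> n u) = \<bar>\<epsilon>\<bar> * sob_norm s u"
proof -
  have eq: "jap (of_int k) powr (2 * s) * (cmod (rot \<epsilon> \<theta> n u k))\<^sup>2
      = jap (of_int k) powr (2 * s) * (cmod (of_real \<epsilon> * u k))\<^sup>2" for k
    by (simp add: rot_def norm_mult)
  show "sob s (rot \<epsilon> \<theta> n u)"
    using sob_scale[OF assms, of "of_real \<epsilon>"] unfolding sob_def eq .
  show "sob_norm s (rot \<epsilon> \<theta> n u) = \<bar>\<epsilon>\<bar> * sob_norm s u"
    using sob_norm_scale[OF assms, of "of_real \<epsilon>"] unfolding sob_norm_def eq by simp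
qed

lemma rot_in_sball:
  assumes "couple u \<in> sball s r" "0 < \<epsilon>" "\<epsilon> \<le> 1"
  shows "couple (rot \<epsilon> \<theta> n u) \<in> sball s r"
proof -
  have "\<epsilon> * sob_norm s u \<le> 1 * sob_norm s u"
    using assms sob_norm_nonneg by (intro mult_right_mono) auto
  then show ?thesis
    using assms by (auto simp: couple_in_sball sob_rot sob_norm_rot elim: order_le_less_trans[rotated])
qed

text \<open>Since the first component of the field is \<i> times the second component of the
  gradient, the sum is -1/2 times the derivative of H along the orbit. H returns to its value after
  a full turn, so Rolle's theorem gives a zero.\<close>

lemma hamiltonian_stationary_on_orbit:
  assumes Y: "hamiltonian_field s0 r Y" and u: "couple u \<in> sball s0 r" "0 < \<epsilon>" "\<epsilon> \<le> 1"
  shows "\<exists>\<theta>. (\<Sum>k | nat \<bar>k\<bar> = n. Re (cnj (rot \<epsilon> \<theta> n u k) * Y (couple (rot \<epsilon> \<theta> n u)) Pl k)) = 0"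
proof -
  obtain H where H: "\<And>v. couple v \<in> sball s0 r \<Longrightarrow> \<exists>G. has_gradient s0 H G v \<and> Y (couple v) Pl = (\<lambda>n. \<i> * G Mi n)"
    using Y unfolding hamiltonian_field_def by blast
  let ?v = "\<lambda>\<theta>. rot \<epsilon> \<theta> n u"
  define F where "F \<theta> = (\<Sum>k | nat \<bar>k\<bar> = n. Re (cnj (?v \<theta> k) * Y (couple (?v \<theta>)) Pl k))" for \<theta>
  have D: "((\<lambda>\<theta>. H (couple (?v \<theta>))) has_real_derivative - 2 * F \<theta>) (at \<theta>)" for \<theta>
  proof -
    obtain G where G: "has_gradient s0 H G (?v \<theta>)" "Y (couple (?v \<theta>)) Pl = (\<lambda>n. \<i> * G Mi n)"
      using H[OF rot_in_sball[OF u]] by blast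
    have "((\<lambda>\<tau>. H (couple (?v \<tau>))) has_real_derivative
        2 * Re (\<Sum>k | nat \<bar>k\<bar> = n. G Mi k * cnj (\<i> * ?v \<theta> k))) (at \<theta>)"
    proof (rule has_gradient_chain[where \<gamma> = ?v, OF G(1)])
      show "?v \<tau> k = ?v \<theta> k" if "k \<notin> {k. nat \<bar>k\<bar> = n}" for \<tau> k
        using that by (simp add: rot_def phase_def)
      show "((\<lambda>\<tau>. ?v \<tau> k) has_vector_derivative \<i> * ?v \<theta> k) (at \<theta>)" if "k \<in> {k. nat \<bar>k\<bar> = n}" for k
        using rot_has_vector_derivative[of \<epsilon> n u k \<theta>] that by simp
    qed simp
    also have "2 * Re (\<Sum>k | nat \<bar>k\<bar> = n. G Mi k * cnj (\<i> * ?v \<theta> k)) = - 2 * F \<theta>"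
      by (simp add: F_def G(2) sum_distrib_left algebra_simps flip: sum_subtractf sum_negf)
    finally show ?thesis .
  qed
  have "\<exists>\<theta>. 0 < \<theta> \<and> \<theta> < 2 * pi \<and> - 2 * F \<theta> = 0"
  proof (rule exE[OF Rolle_deriv[of 0 "2 * pi" "\<lambda>\<theta>. H (couple (?v \<theta>))" "\<lambda>\<theta> h. - 2 * F \<theta> * h"]])
    show "continuous_on {0..2 * pi} (\<lambda>\<theta>. H (couple (?v \<theta>)))"
      using D by (intro continuous_at_imp_continuous_on ballI DERIV_isCont)
    show "((\<lambda>\<theta>. H (couple (?v \<theta>))) has_derivative (\<lambda>h. - 2 * F \<theta> * h)) (at \<theta>)" for \<theta>
      using D has_field_derivative_imp_has_derivative by blast
    show "\<exists>\<theta>. 0 < \<theta> \<and> \<theta> < 2 * pi \<and> - 2 * F \<theta> = 0"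
      if "0 < z \<and> z < 2 * pi \<and> (\<lambda>h. - 2 * F z * h) = (\<lambda>v. 0)" for z
      \<comment> \<open>The zero linear map is evaluated at 1 to recover its coefficient.\<close>
      using that by (metis mult.right_neutral)
  qed (auto simp: rot_period)
  then show ?thesis by (auto simp: F_def)
qed

section \<open>Bounds, homogeneity and reality\<close>

text \<open>This is the estimate without derivatives at s = s0, where \<open>gain\<close> collapses
  to p times the p-th power of the norm.\<close>

lemma nonhom_symbol_bound:
  assumes "nonhom_symbol d s0 r \<mu>' p a" "p \<ge> 1"
  obtains r0 C where "0 < r0" "\<And>U x \<xi>. U \<in> sball s0 r0 \<Longrightarrow>
    cmod (a U x \<xi>) \<le> C * jap \<xi> powr \<mu>' * vsob_norm s0 U ^ p"
proof -
  obtain r0 D where r0: "0 < r0"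
    and D: "\<forall>x \<xi>. frechet_tower s0 (sball s0 r0 \<inter> {U. vsob s0 U}) (\<lambda>k z e. cmod z \<le> e)
              (\<lambda>k. d * real k \<le> s0 - s0) (\<lambda>U. a U x \<xi>) (\<lambda>k U hs. D k U hs x \<xi>)"
    and bd: "\<forall>\<beta>. \<exists>C>0. \<forall>\<alpha> k U hs. real \<alpha> + d * real k \<le> s0 - s0 \<and>
           U \<in> sball s0 r0 \<and> vsob s0 U \<and> length hs = k \<and> (\<forall>h\<in>set hs. vsob s0 h) \<longrightarrow>
             has_pds \<alpha> (D k U hs) \<and>
             (\<forall>x \<xi>. cmod (pd \<alpha> \<beta> (D k U hs) x \<xi>)
                \<le> C * jap \<xi> powr (\<mu>' - real \<beta>) * gain p s0 (vsob_norm (s0 + real \<alpha>)) U hs)"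
    using assms(1)[unfolded nonhom_symbol_def, THEN conjunct2, THEN spec[of _ s0], THEN mp, OF order_refl]
    by (elim exE conjE) (rule that; assumption)
  obtain C where C: "\<forall>\<alpha> k U hs. real \<alpha> + d * real k \<le> s0 - s0 \<and>
           U \<in> sball s0 r0 \<and> vsob s0 U \<and> length hs = k \<and> (\<forall>h\<in>set hs. vsob s0 h) \<longrightarrow>
             has_pds \<alpha> (D k U hs) \<and>
             (\<forall>x \<xi>. cmod (pd \<alpha> 0 (D k U hs) x \<xi>)
                \<le> C * jap \<xi> powr (\<mu>' - real 0) * gain p s0 (vsob_norm (s0 + real \<alpha>)) U hs)"
    using bd by blast
  show thesis
  proof (rule that[of r0 "C * real p"])
    fix U x \<xi> assume U: "U \<in> sball s0 r0"
    then have "vsob s0 U" by (simp add: sball_def)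
    then have "D 0 U [] x \<xi> = a U x \<xi>"
      using D U unfolding frechet_tower_def by blast
    moreover have "cmod (D 0 U [] x \<xi>) \<le> C * jap \<xi> powr \<mu>' * gain p s0 (vsob_norm s0) U []"
      using C[rule_format, of 0 0 U "[]"] U \<open>vsob s0 U\<close> by (simp add: pd_def)
    ultimately show "cmod (a U x \<xi>) \<le> C * real p * jap \<xi> powr \<mu>' * vsob_norm s0 U ^ p"
      using assms(2) by (cases p) (simp_all add: gain_Nil algebra_simps)
  qed (rule r0)
qed

text \<open>The estimate without differentials, applied to the components of the couple itself; the
  smoothing gain \<rho> is given up.\<close>

lemma nonhom_smoothing_bound:
  assumes "nonhom_smoothing d s0 r \<rho> p R" "p \<ge> 1" "\<rho> \<ge> 0" "s0 \<le> s"
  obtains r0 C where "0 < r0" "0 < C"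
    "\<And>u \<sigma>. couple u \<in> sball s0 r0 \<Longrightarrow> sob s u \<Longrightarrow> sob s (R (couple u) (couple u \<sigma>)) \<and>
       sob_norm s (R (couple u) (couple u \<sigma>)) \<le> C * sob_norm s0 u ^ p * sob_norm s u"
proof -
  obtain C r0 D where C: "C > 0" and r0: "0 < r0"
    and D: "\<forall>u. sob s u \<longrightarrow> frechet_tower s (sball s0 r0 \<inter> {V. vsob s V})
            (\<lambda>k z e. sob (s + \<rho> - d * real k) z \<and> sob_norm (s + \<rho> - d * real k) z \<le> e)
            (\<lambda>k. d * real k \<le> s - s0) (\<lambda>V. R V u) (\<lambda>k V hs. D k V hs u)"
    and bd: "\<forall>k V u. d * real k \<le> s - s0 \<and> V \<in> sball s0 r0 \<and> vsob s V \<and> sob s u \<longrightarrow>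
           (\<forall>n. multilinear_on \<real> {h. vsob s h} k (\<lambda>hs. D k V hs u n)) \<and>
           (\<forall>hs. length hs = k \<and> (\<forall>h\<in>set hs. vsob s h) \<longrightarrow>
              sob (s + \<rho> - d * real k) (D k V hs u) \<and>
              sob_norm (s + \<rho> - d * real k) (D k V hs u)
                \<le> C * (gain p s0 (vsob_norm s) V hs * sob_norm s0 u
                     + vsob_norm s0 V ^ (p - k) * sob_norm s u * (\<Prod>h\<leftarrow>hs. vsob_norm s0 h)))"
    using assms(1)[unfolded nonhom_smoothing_def, THEN conjunct2, THEN spec[of _ s], THEN mp, OF assms(4)]
    by (elim exE conjE) (rule that; assumption)
  \<comment> \<open>The \<open>gain\<close> term contributes p and the other term 1; sqrt 2 ^ p
    comes from passing from the norm of the couple to that of u in p factors.\<close>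
  show thesis
  proof (rule that[of r0 "C * (real p + 1) * sqrt 2 ^ p"])
    fix u \<sigma> assume u: "couple u \<in> sball s0 r0" "sob s u"
    define v where "v = couple u \<sigma>"
    have v: "sob s v" "\<And>s'. sob_norm s' v = sob_norm s' u"
      using u by (cases \<sigma>; simp add: v_def)+
    have "D 0 (couple u) [] v = R (couple u) v"
      using D v(1) u unfolding frechet_tower_def by simp
    then have *: "sob (s + \<rho>) (R (couple u) v)"
      "sob_norm (s + \<rho>) (R (couple u) v) \<le> C * (gain p s0 (vsob_norm s) (couple u) [] * sob_norm s0 v
          + vsob_norm s0 (couple u) ^ p * sob_norm s v)"
      using bd[rule_format, of 0 "couple u" v] assms(4) u v(1) by auto
    have "sob_norm s (R (couple u) v) \<le> sob_norm (s + \<rho>) (R (couple u) v)"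
      using * assms(3) by (intro sob_norm_mono) auto
    also have "\<dots> \<le> C * (gain p s0 (vsob_norm s) (couple u) [] * sob_norm s0 v
          + vsob_norm s0 (couple u) ^ p * sob_norm s v)" by (rule *)
    also have "\<dots> = C * (real p + 1) * sqrt 2 ^ p * sob_norm s0 u ^ p * sob_norm s u"
      using assms(2) by (cases p) (auto simp: gain_Nil v(2) vsob_norm_couple power_mult_distrib algebra_simps)
    finally show "sob s (R (couple u) (couple u \<sigma>)) \<and> sob_norm s (R (couple u) (couple u \<sigma>))
        \<le> C * (real p + 1) * sqrt 2 ^ p * sob_norm s0 u ^ p * sob_norm s u"
      using sob_mono[OF *(1), of s] assms(3) by (simp add: v_def)
  qed (use C r0 in auto)
qed

section \<open>Homogeneity and reality of the symbol components\<close>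

lemma multilinear_on_scale:
  assumes f: "multilinear_on UNIV S p f" and S: "0 \<in> S" "\<And>V. V \<in> S \<Longrightarrow> (\<lambda>\<sigma> n. c * V \<sigma> n) \<in> S"
    and Us: "length Us = p" "set Us \<subseteq> S"
  shows "f (map (\<lambda>V \<sigma> n. c * V \<sigma> n) Us) = c ^ p * f Us"
proof -
  let ?g = "\<lambda>V \<sigma> n. c * V \<sigma> n"
  have S0: "(\<lambda>\<sigma> n. 0) \<in> S" using S(1) by (simp add: zero_fun_def)
  \<comment> \<open>The affine form of multilinearity with c = 1 and V = 0 reads f = f + f. With 0
    in a slot, the same identity for general V then pulls a scalar out of that slot.\<close>
  have zero: "f (Vs[i := 0]) = 0" if "length Vs = p" "set Vs \<subseteq> S" "i < p" for Vs i
  proof -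
    have "f ((Vs[i := 0])[i := (\<lambda>\<sigma> n. 1 * (0 :: vec) \<sigma> n) + Vs[i := 0] ! i]) = 1 * f ((Vs[i := 0])[i := 0]) + f (Vs[i := 0])"
      using that S S0 set_update_subset_insert[of Vs i 0]
      by (intro f[unfolded multilinear_on_def, rule_format]) auto
    moreover have "(\<lambda>\<sigma> n. 1 * (0 :: vec) \<sigma> n) + Vs[i := 0] ! i = 0"
      using that by (simp add: fun_eq_iff)
    ultimately show ?thesis by simp
  qed
  have step: "f (Vs[i := ?g V]) = c * f (Vs[i := V])" if "length Vs = p" "set Vs \<subseteq> S" "i < p" "V \<in> S" for Vs i V
  proof -
    have "f ((Vs[i := 0])[i := ?g V + Vs[i := 0] ! i]) = c * f ((Vs[i := 0])[i := V]) + f (Vs[i := 0])"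
      using that S S0 set_update_subset_insert[of Vs i 0]
      by (intro f[unfolded multilinear_on_def, rule_format]) auto
    moreover have "?g V + Vs[i := 0] ! i = ?g V"
      using that by (simp add: fun_eq_iff)
    ultimately show ?thesis using zero that by simp
  qed
  \<comment> \<open>The arguments are scaled one after the other from the left.\<close>
  have "j \<le> p \<Longrightarrow> f (map ?g (take j Us) @ drop j Us) = c ^ j * f Us" for j
  proof (induction j)
    case (Suc j)
    define L where "L = map ?g (take j Us) @ drop j Us"
    have j: "j < p" using Suc by simp
    have L: "length L = p" "set L \<subseteq> S"
      using Us j S set_take_subset[of j Us] set_drop_subset[of j Us] by (auto simp: L_def)
    have "map ?g (take (Suc j) Us) @ drop (Suc j) Us = L[j := ?g (Us ! j)]"
      using Us j by (intro nth_equalityI) (auto simp: L_def nth_append nth_list_update min_def less_Suc_eq)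
    moreover have "L = L[j := Us ! j]"
      using Us j by (intro nth_equalityI) (auto simp: L_def nth_append nth_list_update min_def)
    moreover have "Us ! j \<in> S" using Us j by auto
    ultimately show ?case using step[OF L j, of "Us ! j"] Suc j by (simp flip: L_def)
  qed simp
  from this[of p] show ?thesis using Us by simp
qed

lemma couple_scale: "couple (\<lambda>n. of_real \<epsilon> * u n) = (\<lambda>\<sigma> n. of_real \<epsilon> * couple u \<sigma> n)"
proof
  show "couple (\<lambda>n. of_real \<epsilon> * u n) \<sigma> = (\<lambda>n. of_real \<epsilon> * couple u \<sigma> n)" for \<sigma>
    by (cases \<sigma>) (simp_all add: fconj_def)
qed

lemma vproj_smooth: "vproj n U \<in> smooth_vecs"
  unfolding smooth_vecs_def vsob_def
  by (auto simp: vproj_def proj_def split: if_splits intro!: sob_finite_support[OF finite_modes[of n]])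

text \<open>Each term of the series has projected, hence smooth, arguments, so multilinearity
  applies termwise; a constant factor leaves \<open>infsum\<close> whether or not the series
  converges.\<close>

lemma hom_eval_scale:
  assumes "hom_symbol \<mu>' q a"
  shows "hom_eval q a (\<lambda>\<sigma> n. c * U \<sigma> n) x \<xi> = c ^ q * hom_eval q a U x \<xi>"
proof -
  have "a (vprojs ns (replicate q (\<lambda>\<sigma> n. c * U \<sigma> n))) x \<xi> = c ^ q * a (vprojs ns (replicate q U)) x \<xi>"
    if ns: "length ns = q" for ns
  proof -
    let ?L = "vprojs ns (replicate q U)"
    have eq: "vprojs ns (replicate q (\<lambda>\<sigma> n. c * U \<sigma> n)) = map (\<lambda>V \<sigma> n. c * V \<sigma> n) ?L"
      using ns by (intro nth_equalityI) (auto simp: vprojs_def vproj_def proj_def fun_eq_iff)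
    show ?thesis
      unfolding eq
    proof (rule multilinear_on_scale[where S = smooth_vecs])
      show "multilinear_on UNIV smooth_vecs q (\<lambda>Us. a Us x \<xi>)"
        using assms by (simp add: hom_symbol_def)
      show "0 \<in> smooth_vecs"
        by (auto simp: smooth_vecs_def vsob_def intro!: sob_finite_support[of "{}"])
      show "(\<lambda>\<sigma> n. c * V \<sigma> n) \<in> smooth_vecs" if "V \<in> smooth_vecs" for V
        using that by (auto simp: smooth_vecs_def vsob_def intro: sob_scale)
      show "length ?L = q" using ns by (simp add: vprojs_def)
      show "set ?L \<subseteq> smooth_vecs" by (auto simp: vprojs_def vproj_smooth)
    qed
  qed
  then show ?thesis
    unfolding hom_eval_def infsum_cmult_right'[symmetric] by (intro infsum_cong) auto
qed

lemma scale_in_sball: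
  assumes "couple u \<in> sball s r" "0 < \<epsilon>" "\<epsilon> * (sqrt 2 * sob_norm s u) < r'"
  shows "couple (\<lambda>n. of_real \<epsilon> * u n) \<in> sball s r'"
  using assms by (simp add: couple_in_sball sob_scale sob_norm_scale algebra_simps)

text \<open>
  Homogeneity separates the orders in \<open>\<epsilon>\<close> of the values at \<open>\<epsilon>u\<close>, so every component of a real sum is real.
\<close>

lemma nonhom_part_real:
  assumes a: "sum_symbol d s0 r N \<mu>' p a" and "real_valued s0 r N p a" "N \<ge> 1"
    and u: "couple u \<in> sball s0 r"
  shows "Im (snd a (couple u) x \<xi>) = 0"
proof -
  define c where "c q = Im (hom_eval q (fst a q) (couple u) x \<xi>)" for q
  define b where "b = sqrt 2 * sob_norm s0 u"
  have b: "b < r" "0 \<le> b" "sob s0 u" using u sob_norm_nonneg by (auto simp: couple_in_sball b_def)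
  have sum0: "(\<Sum>q\<in>{p..<N}. c q * \<epsilon> ^ q) + Im (snd a (couple (\<lambda>n. of_real \<epsilon> * u n)) x \<xi>) = 0"
    if \<epsilon>: "0 < \<epsilon>" "\<epsilon> \<le> 1" for \<epsilon>
  proof -
    have "\<epsilon> * b \<le> 1 * b" using \<epsilon> b by (intro mult_right_mono) auto
    then have "\<epsilon> * b < r" using b by simp
    then have "couple (\<lambda>n. of_real \<epsilon> * u n) \<in> sball s0 r"
      unfolding b_def by (rule scale_in_sball[OF u \<epsilon>(1)])
    then have "sum_eval N p a (couple (\<lambda>n. of_real \<epsilon> * u n)) x \<xi> \<in> \<real>"
      using assms(2) by (simp add: real_valued_def)
    moreover have "Im (hom_eval q (fst a q) (couple (\<lambda>n. of_real \<epsilon> * u n)) x \<xi>) = c q * \<epsilon> ^ q"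
      if "q \<in> {p..<N}" for q
    proof -
      have "hom_symbol \<mu>' q (fst a q)" using a that by (simp add: sum_symbol_def)
      then show ?thesis
        unfolding couple_scale by (simp add: hom_eval_scale c_def Im_power_real flip: of_real_power)
    qed
    ultimately show ?thesis by (simp add: sum_eval_def complex_is_Real_iff)
  qed
  obtain r0 C where r0: "0 < r0" and C: "\<And>U x \<xi>. U \<in> sball s0 r0 \<Longrightarrow>
      cmod (snd a U x \<xi>) \<le> C * jap \<xi> powr \<mu>' * vsob_norm s0 U ^ N"
    using nonhom_symbol_bound a assms(3) unfolding sum_symbol_def by blast
  have "c q = 0" if "q \<in> {p..<N}" for q
  proof (rule polynomial_coeffs_zero[OF _ _ that])
    \<comment> \<open>The two bounds on \<epsilon> keep \<epsilon>u in the ball of radius r and in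
      the one where the remainder is estimated; b + 1 avoids a zero denominator.\<close>
    show "0 < min 1 (r0 / (b + 1))" using r0 b by simp
    fix \<epsilon> :: real assume \<epsilon>: "0 < \<epsilon>" "\<epsilon> < min 1 (r0 / (b + 1))"
    have "\<epsilon> * b \<le> \<epsilon> * (b + 1)" using \<epsilon> by simp
    also have "\<dots> < r0" using \<epsilon> b by (simp add: field_simps)
    finally have "couple (\<lambda>n. of_real \<epsilon> * u n) \<in> sball s0 r0"
      using u \<epsilon> unfolding b_def by (intro scale_in_sball) auto
    from C[OF this, of x \<xi>] have "cmod (snd a (couple (\<lambda>n. of_real \<epsilon> * u n)) x \<xi>)
        \<le> C * jap \<xi> powr \<mu>' * b ^ N * \<epsilon> ^ N"
      using \<epsilon> b by (simp add: vsob_norm_couple sob_norm_scale b_def power_mult_distrib algebra_simps)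
    then show "\<bar>\<Sum>q\<in>{p..<N}. c q * \<epsilon> ^ q\<bar> \<le> C * jap \<xi> powr \<mu>' * b ^ N * \<epsilon> ^ N"
      using sum0[of \<epsilon>] abs_Im_le_cmod[of "snd a (couple (\<lambda>n. of_real \<epsilon> * u n)) x \<xi>"] \<epsilon> by auto
  qed
  \<comment> \<open>At \<epsilon> = 1 the identity now contains only the nonhomogeneous
    part.\<close>
  then show ?thesis using sum0[of 1] by simp
qed

section \<open>Conservation of the super actions and the energy estimate\<close>

text \<open>Paradifferential and smoothing terms of the same degree are kept together, since
  comparing orders in \<epsilon> controls only their sum.\<close>

definition hom_part :: "cutoff_fun \<Rightarrow> nat \<Rightarrow> hsym \<Rightarrow> (sign \<Rightarrow> hop) \<Rightarrow> fn \<Rightarrow> fn" where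
  "hom_part Y q a R u k =
     \<i> * weyl (hom_trunc Y q (res_hsym q a) (replicate q (couple u))) u k
     + (\<Sum>\<sigma>'\<in>{Pl, Mi}. res_hop Pl \<sigma>' q (R \<sigma>') (replicate q (couple u)) (couple u \<sigma>') k)"

text \<open>This is the part of the first component that survives in the energy estimate.\<close>

definition nonhom_smooth_part :: "(sign \<Rightarrow> sign \<Rightarrow> sop) \<Rightarrow> fn \<Rightarrow> fn" where
  "nonhom_smooth_part Q u = (\<Sum>\<sigma>'\<in>{Pl, Mi}. snd (Q Pl \<sigma>') (couple u) (couple u \<sigma>'))"

lemma nonhom_smooth_part_eq:
  "nonhom_smooth_part Q u
   = snd (Q Pl Pl) (couple u) (couple u Pl) + snd (Q Pl Mi) (couple u) (couple u Mi)"
  by (simp add: nonhom_smooth_part_def)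

text \<open>Multiplied by the conjugate of the rotated function, the phase cancels: the contribution
  to the rate of a super action is constant along the orbit and scales like \<epsilon>^(q +
  2).\<close>

lemma hom_part_rot:
  assumes "\<And>Us x y \<xi>. length Us = q \<Longrightarrow> set Us \<subseteq> smooth_vecs \<Longrightarrow> a Us x \<xi> = a Us y \<xi>"
  shows "hom_part Y q a R (rot \<epsilon> \<theta> n u) k = of_real \<epsilon> ^ (q + 1) * phase \<theta> n Pl k * hom_part Y q a R u k"
proof -
  have "weyl (hom_trunc Y q (res_hsym q a) (replicate q (couple (rot \<epsilon> \<theta> n u)))) (rot \<epsilon> \<theta> n u) k
    = of_real \<epsilon> ^ (q + 1) * phase \<theta> n Pl k * weyl (hom_trunc Y q (res_hsym q a) (replicate q (couple u))) u k"
    by (rule weyl_hom_rot) (rule assms)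
  then show ?thesis
    unfolding hom_part_def res_hop_rot by (simp add: algebra_simps)
qed

lemma nf_field_couple:
  assumes "\<And>x y \<xi>. snd a (couple u) x \<xi> = snd a (couple u) y \<xi>"
  shows "nf_field X Xs N \<omega> a Q (couple u) Pl k =
     \<i> * of_real (\<omega> k) * u k
     + (\<Sum>q\<in>{2..<N}. hom_part (Xs q) q (fst a q) (\<lambda>\<sigma>'. fst (Q Pl \<sigma>') q) u k)
     + \<i> * (of_real (X [0] (of_int k)) * snd a (couple u) 0 (of_int k) * u k)
     + nonhom_smooth_part Q u k"
  using assms
  by (simp add: nf_field_def op_bw_def res_diag_def res_sym_def res_sop_apply_def hom_part_def
      nonhom_smooth_part_def sum_fun_apply weyl_nonhom_diagonal sum.distrib sum_distrib_left algebra_simps)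

text \<open>On the orbit of \<epsilon>u the rate is \<epsilon>^2 times a polynomial with
  coefficients \<open>c q\<close>, up to O(\<epsilon>^(N + 2)). It vanishes at some angle for each
  small \<epsilon>, which forces all \<open>c q\<close> to be 0.\<close>

lemma super_action_rate:
  assumes N: "N \<ge> 1" and \<rho>: "\<rho> \<ge> 0"
    and Q: "\<And>\<sigma> \<sigma>'. sum_smoothing d s0 r N \<rho> 2 (Q \<sigma> \<sigma>')"
    and a: "sum_symbol d s0 r N \<mu>' 2 a" "x_independent s0 r N 2 a" "real_valued s0 r N 2 a"
    and Y: "hamiltonian_field s0 r (nf_field X Xs N \<omega> a Q)"
    and u: "couple u \<in> sball s0 r"
  shows "(\<Sum>k | nat \<bar>k\<bar> = n. Re (cnj (u k) * nf_field X Xs N \<omega> a Q (couple u) Pl k))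
    = (\<Sum>k | nat \<bar>k\<bar> = n. Re (cnj (u k) * nonhom_smooth_part Q u k))"
proof -
  let ?K = "{k :: int. nat \<bar>k\<bar> = n}"
  let ?h = "\<lambda>q. hom_part (Xs q) q (fst a q) (\<lambda>\<sigma>'. fst (Q Pl \<sigma>') q)"
  let ?v = "\<lambda>\<epsilon> \<theta>. rot \<epsilon> \<theta> n u"
  define c where "c q = (\<Sum>k\<in>?K. Re (cnj (u k) * ?h q u k))" for q
  have xind: "fst a q Us x \<xi> = fst a q Us y \<xi>"
    if "q \<in> {2..<N}" "length Us = q" "set Us \<subseteq> smooth_vecs" for q Us x y \<xi>
    using a(2) that unfolding x_independent_def by blast
  have rate: "(\<Sum>k\<in>?K. Re (cnj (v k) * nf_field X Xs N \<omega> a Q (couple v) Pl k))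
      = (\<Sum>q\<in>{2..<N}. \<Sum>k\<in>?K. Re (cnj (v k) * ?h q v k))
        + (\<Sum>k\<in>?K. Re (cnj (v k) * nonhom_smooth_part Q v k))"
    if v: "couple v \<in> sball s0 r" for v
  proof -
    have xi: "snd a (couple v) x \<xi> = snd a (couple v) y \<xi>" for x y \<xi>
      using a(2) v unfolding x_independent_def by blast
    have "Re (cnj (v k) * nf_field X Xs N \<omega> a Q (couple v) Pl k)
        = (\<Sum>q\<in>{2..<N}. Re (cnj (v k) * ?h q v k)) + Re (cnj (v k) * nonhom_smooth_part Q v k)" for k
    proof -
      \<comment> \<open>Multiplication by \<i> times a real number does not change the modulus of a
        mode. This removes the linear part and, by \<open>nonhom_part_real\<close>, the
        paradifferential remainder.\<close>
      have "Re (cnj (v k) * (\<i> * z * v k)) = - Im z * (cmod (v k))\<^sup>2" for z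
        unfolding cmod_power2 by (simp add: algebra_simps power2_eq_square)
      from this[of "of_real (\<omega> k)"] this[of "of_real (X [0] (of_int k)) * snd a (couple v) 0 (of_int k)"]
      have "Re (cnj (v k) * (\<i> * of_real (\<omega> k) * v k)) = 0"
        "Re (cnj (v k) * (\<i> * (of_real (X [0] (of_int k)) * snd a (couple v) 0 (of_int k) * v k))) = 0"
        using nonhom_part_real[OF a(1,3) N v] by (simp_all add: mult.assoc)
      then show ?thesis
        unfolding nf_field_couple[OF xi] ring_distribs plus_complex.sel sum_distrib_left Re_sum by simp
    qed
    then show ?thesis by (simp add: sum.distrib sum.swap[of _ "{2..<N}"])
  qed
  have R: "nonhom_smoothing d s0 r \<rho> N (snd (Q Pl \<sigma>'))" for \<sigma>'
    using Q by (simp add: sum_smoothing_def)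
  obtain r1 C1 where r1: "0 < r1" "0 < C1" and C1: "\<And>u \<sigma>. couple u \<in> sball s0 r1 \<Longrightarrow> sob s0 u \<Longrightarrow>
      sob s0 (snd (Q Pl Pl) (couple u) (couple u \<sigma>)) \<and>
      sob_norm s0 (snd (Q Pl Pl) (couple u) (couple u \<sigma>)) \<le> C1 * sob_norm s0 u ^ N * sob_norm s0 u"
    using nonhom_smoothing_bound[OF R N \<rho> order_refl] by metis
  obtain r2 C2 where r2: "0 < r2" "0 < C2" and C2: "\<And>u \<sigma>. couple u \<in> sball s0 r2 \<Longrightarrow> sob s0 u \<Longrightarrow>
      sob s0 (snd (Q Pl Mi) (couple u) (couple u \<sigma>)) \<and>
      sob_norm s0 (snd (Q Pl Mi) (couple u) (couple u \<sigma>)) \<le> C2 * sob_norm s0 u ^ N * sob_norm s0 u"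
    using nonhom_smoothing_bound[OF R N \<rho> order_refl] by metis
  have su: "sob s0 u" using u by (simp add: couple_in_sball)
  define b where "b = sqrt 2 * sob_norm s0 u"
  have b: "0 \<le> b" using sob_norm_nonneg by (simp add: b_def)
  \<comment> \<open>\<open>B\<close> and \<open>C\<close> bound the smoothing remainder and its
    contribution to the rate after the powers of \<epsilon> have been factored out.\<close>
  define B where "B = (C1 + C2) * sob_norm s0 u ^ (N + 1)"
  define C where "C = (\<Sum>k\<in>?K. cmod (u k) * (jap (of_int k) powr (- s0) * B))"
  have "c q = 0" if "q \<in> {2..<N}" for q
  proof (rule polynomial_coeffs_zero[OF _ _ that])
    show "0 < min 1 (min r1 r2 / (b + 1))" using r1 r2 b by simp
    fix \<epsilon> :: real assume \<epsilon>: "0 < \<epsilon>" "\<epsilon> < min 1 (min r1 r2 / (b + 1))"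
    \<comment> \<open>The angle depends on \<epsilon>, which is harmless: the homogeneous
      contribution is independent of it and the remainder is bounded uniformly in it.\<close>
    obtain \<theta> where \<theta>: "(\<Sum>k\<in>?K. Re (cnj (?v \<epsilon> \<theta> k) * nf_field X Xs N \<omega> a Q (couple (?v \<epsilon> \<theta>)) Pl k)) = 0"
      using hamiltonian_stationary_on_orbit[OF Y u, of \<epsilon> n] \<epsilon> by auto
    define v where "v = ?v \<epsilon> \<theta>"
    have v: "couple v \<in> sball s0 r" unfolding v_def using \<epsilon> by (intro rot_in_sball[OF u]) auto
    have sv: "sob s0 v" "sob_norm s0 v = \<epsilon> * sob_norm s0 u"
      using \<epsilon> by (simp_all add: v_def sob_rot[OF su] sob_norm_rot[OF su])
    have "\<epsilon> * b \<le> \<epsilon> * (b + 1)" using \<epsilon> by simp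
    also have "\<dots> < min r1 r2" using \<epsilon> b by (simp add: field_simps)
    finally have small: "couple v \<in> sball s0 r1" "couple v \<in> sball s0 r2"
      using sv by (auto simp: couple_in_sball b_def algebra_simps)
    have Rv: "cmod (nonhom_smooth_part Q v k) \<le> jap (of_int k) powr (- s0) * B * \<epsilon> ^ (N + 1)" for k
    proof -
      let ?R1 = "snd (Q Pl Pl) (couple v) (couple v Pl)" and ?R2 = "snd (Q Pl Mi) (couple v) (couple v Mi)"
      have S: "sob s0 ?R1" "sob s0 ?R2" using C1 C2 small sv(1) by blast+
      have "jap (of_int k) powr s0 * cmod (nonhom_smooth_part Q v k) \<le> sob_norm s0 (nonhom_smooth_part Q v)"
        unfolding nonhom_smooth_part_eq by (intro coeff_le_sob_norm sob_add S)
      also have "\<dots> \<le> sob_norm s0 ?R1 + sob_norm s0 ?R2"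
        unfolding nonhom_smooth_part_eq by (rule sob_norm_triangle[OF S])
      also have "\<dots> \<le> C1 * sob_norm s0 v ^ N * sob_norm s0 v + C2 * sob_norm s0 v ^ N * sob_norm s0 v"
        using C1 C2 small sv(1) by (intro add_mono) blast+
      also have "\<dots> = B * \<epsilon> ^ (N + 1)"
        by (simp add: sv B_def power_mult_distrib algebra_simps)
      finally have "jap (of_int k) powr (- s0) * (jap (of_int k) powr s0 * cmod (nonhom_smooth_part Q v k))
          \<le> jap (of_int k) powr (- s0) * (B * \<epsilon> ^ (N + 1))"
        by (rule mult_left_mono) simp
      moreover have "jap (of_int k) powr (- s0) * jap (of_int k) powr s0 = 1"
        using jap_pos[of "of_int k"] by (simp flip: powr_add)
      ultimately show ?thesis by (simp add: mult.assoc[symmetric])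
    qed
    have vk: "cmod (v k) = \<epsilon> * cmod (u k)" for k
      using \<epsilon> by (simp add: v_def rot_def norm_mult)
    have "\<bar>\<Sum>k\<in>?K. Re (cnj (v k) * nonhom_smooth_part Q v k)\<bar> \<le> (\<Sum>k\<in>?K. \<bar>Re (cnj (v k) * nonhom_smooth_part Q v k)\<bar>)"
      by (rule sum_abs)
    also have "\<dots> \<le> (\<Sum>k\<in>?K. cmod (v k) * (jap (of_int k) powr (- s0) * B * \<epsilon> ^ (N + 1)))"
    proof (rule sum_mono)
      fix k
      have "\<bar>Re (cnj (v k) * nonhom_smooth_part Q v k)\<bar> \<le> cmod (v k) * cmod (nonhom_smooth_part Q v k)"
        using abs_Re_le_cmod[of "cnj (v k) * nonhom_smooth_part Q v k"] by (simp add: norm_mult)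
      also have "\<dots> \<le> cmod (v k) * (jap (of_int k) powr (- s0) * B * \<epsilon> ^ (N + 1))"
        using Rv by (rule mult_left_mono) simp
      finally show "\<bar>Re (cnj (v k) * nonhom_smooth_part Q v k)\<bar>
          \<le> cmod (v k) * (jap (of_int k) powr (- s0) * B * \<epsilon> ^ (N + 1))" .
    qed
    \<comment> \<open>One factor \<epsilon> comes from v and N + 1 from the remainder; two are split
      off to match the homogeneous terms.\<close>
    also have "\<dots> = \<epsilon>\<^sup>2 * (C * \<epsilon> ^ N)"
      by (simp add: C_def vk sum_distrib_left sum_distrib_right power2_eq_square algebra_simps)
    finally have Rsum: "\<bar>\<Sum>k\<in>?K. Re (cnj (v k) * nonhom_smooth_part Q v k)\<bar> \<le> \<epsilon>\<^sup>2 * (C * \<epsilon> ^ N)" .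
    have "(\<Sum>k\<in>?K. Re (cnj (v k) * ?h q v k)) = \<epsilon>\<^sup>2 * (c q * \<epsilon> ^ q)" if q: "q \<in> {2..<N}" for q
    proof -
      have "Re (cnj (v k) * ?h q v k) = \<epsilon>\<^sup>2 * \<epsilon> ^ q * Re (cnj (u k) * ?h q u k)" for k
      proof -
        have "cnj (v k) * ?h q v k
            = of_real (\<epsilon>\<^sup>2 * \<epsilon> ^ q) * (cnj (phase \<theta> n Pl k) * phase \<theta> n Pl k) * (cnj (u k) * ?h q u k)"
        proof -
          have "v k = of_real \<epsilon> * phase \<theta> n Pl k * u k" by (simp add: v_def rot_def)
          moreover have "?h q v k = of_real \<epsilon> ^ (q + 1) * phase \<theta> n Pl k * ?h q u k"
            unfolding v_def by (rule hom_part_rot) (rule xind[OF q])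
          ultimately show ?thesis by (simp add: power2_eq_square algebra_simps)
        qed
        also have "cnj (phase \<theta> n Pl k) * phase \<theta> n Pl k = 1"
          unfolding cnj_phase by (rule phase_opp_mult)
        finally have "cnj (v k) * ?h q v k = of_real (\<epsilon>\<^sup>2 * \<epsilon> ^ q) * (cnj (u k) * ?h q u k)"
          by (simp only: mult_1_right)
        then show ?thesis by (simp only: Re_complex_of_real complex.sel Im_complex_of_real times_complex.sel mult_zero_left diff_zero)
      qed
      then show ?thesis by (simp add: c_def sum_distrib_left algebra_simps)
    qed
    then have "(\<Sum>q\<in>{2..<N}. \<Sum>k\<in>?K. Re (cnj (v k) * ?h q v k)) = \<epsilon>\<^sup>2 * (\<Sum>q\<in>{2..<N}. c q * \<epsilon> ^ q)"
      by (simp add: sum_distrib_left)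
    \<comment> \<open>At the chosen angle the total rate is 0, so the homogeneous sum is minus the
      remainder.\<close>
    then have "\<bar>\<epsilon>\<^sup>2 * (\<Sum>q\<in>{2..<N}. c q * \<epsilon> ^ q)\<bar> \<le> \<epsilon>\<^sup>2 * (C * \<epsilon> ^ N)"
      using rate[OF v] \<theta> Rsum unfolding v_def[symmetric] by linarith
    then have "\<epsilon>\<^sup>2 * \<bar>\<Sum>q\<in>{2..<N}. c q * \<epsilon> ^ q\<bar> \<le> \<epsilon>\<^sup>2 * (C * \<epsilon> ^ N)"
      by (simp only: abs_mult abs_power2)
    then show "\<bar>\<Sum>q\<in>{2..<N}. c q * \<epsilon> ^ q\<bar> \<le> C * \<epsilon> ^ N"
      by (rule mult_left_le_imp_le) (use \<epsilon> in simp)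
  qed
  then show ?thesis using rate[OF u] by (simp add: c_def)
qed

section \<open>Fourier coefficients of solutions and the integrated energy\<close>

lemma solution_coefficients:
  assumes sol: "is_solution m s I B Y (\<lambda>t. couple (w t))" and "m \<ge> 0" "t \<in> I"
  shows "sob s (w t)"
    and "((\<lambda>\<tau>. w \<tau> k) has_vector_derivative Y (couple (w t)) Pl k) (at t within I)"
proof -
  obtain W' where cont: "cont_curve s I (\<lambda>t. couple (w t))" and W': "cont_curve (s - m) I W'"
    "has_curve_derivative (s - m) I (\<lambda>t. couple (w t)) W'" "\<And>t. t \<in> I \<Longrightarrow> W' t = Y (couple (w t))"
    using sol unfolding is_solution_def by blast
  have sob: "sob s (w \<tau>)" if "\<tau> \<in> I" for \<tau>
    using cont that unfolding cont_curve_def by auto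
  then show "sob s (w t)" using assms by blast
  define d where "d \<tau> = (\<lambda>\<sigma> n. (couple (w \<tau>) \<sigma> n - couple (w t) \<sigma> n) / of_real (\<tau> - t) - W' t \<sigma> n)" for \<tau>
  have lim: "((\<lambda>\<tau>. vsob_norm (s - m) (d \<tau>)) \<longlongrightarrow> 0) (at t within I)"
    using W'(2) assms(3) unfolding has_curve_derivative_def d_def by blast
  have "jap (of_int k) powr (s - m) * cmod (d \<tau> Pl k) \<le> vsob_norm (s - m) (d \<tau>)" if "\<tau> \<in> I" for \<tau>
  proof -
    \<comment> \<open>The error must be shown to lie in H^(s-m) before its norm can bound a
      coefficient: on a non-summable sequence \<open>sob_norm\<close> has the default value
      0.\<close>
    have "d \<tau> Pl = (\<lambda>n. (1 / of_real (\<tau> - t)) * (w \<tau> - w t) n) - W' t Pl"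
      by (simp add: d_def fun_eq_iff)
    moreover have "sob (s - m) (w \<tau> - w t)"
      using sob[OF that] sob[OF assms(3)] assms(2) by (intro sob_diff) (auto intro: sob_mono)
    moreover have "sob (s - m) (W' t Pl)"
      using W'(1) assms(3) unfolding cont_curve_def vsob_def by blast
    ultimately have "sob (s - m) (d \<tau> Pl)" by (simp only: sob_diff sob_scale)
    from coeff_le_sob_norm[OF this] show ?thesis using sob_norm_le_vsob_norm order_trans by blast
  qed
  then have "\<forall>\<^sub>F \<tau> in at t within I. norm (jap (of_int k) powr (s - m) * cmod (d \<tau> Pl k)) \<le> vsob_norm (s - m) (d \<tau>)"
    unfolding eventually_at_filter by simp
  from Lim_null_comparison[OF this lim]
  have "((\<lambda>\<tau>. jap (of_int k) powr (s - m) * cmod (d \<tau> Pl k)) \<longlongrightarrow> 0) (at t within I)" .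
  then have "((\<lambda>\<tau>. cmod (d \<tau> Pl k)) \<longlongrightarrow> 0) (at t within I)"
    using tendsto_mult_left_iff[of "jap (of_int k) powr (s - m)" "\<lambda>\<tau>. cmod (d \<tau> Pl k)" 0 "at t within I"]
      jap_pos[of "of_int k"] by simp
  then show "((\<lambda>\<tau>. w \<tau> k) has_vector_derivative Y (couple (w t)) Pl k) (at t within I)"
    unfolding has_vector_derivative_iff_quotient tendsto_norm_zero_iff
    by (simp add: d_def LIM_zero_iff W'(3)[OF assms(3)])
qed

text \<open>By the reverse triangle inequality the norm is continuous in time, which makes the
  integrand of the energy estimate integrable.\<close>

lemma continuous_on_solution_norm:
  assumes "cont_curve s I (\<lambda>t. couple (w t))"
  shows "continuous_on I (\<lambda>t. sob_norm s (w t))"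
  unfolding continuous_on_def
proof
  fix t assume t: "t \<in> I"
  have sob: "sob s (w \<tau>)" if "\<tau> \<in> I" for \<tau>
    using assms that unfolding cont_curve_def by auto
  have lim: "((\<lambda>\<tau>. vsob_norm s (couple (w \<tau>) - couple (w t))) \<longlongrightarrow> 0) (at t within I)"
    using assms t unfolding cont_curve_def by blast
  have "norm (sob_norm s (w \<tau>) - sob_norm s (w t)) \<le> vsob_norm s (couple (w \<tau>) - couple (w t))"
    if "\<tau> \<in> I" for \<tau>
    using sob_norm_abs_diff_le[OF sob[OF that] sob[OF t]]
      sob_norm_le_vsob_norm[of s "couple (w \<tau>) - couple (w t)" Pl] by simp
  then have "\<forall>\<^sub>F \<tau> in at t within I. norm (sob_norm s (w \<tau>) - sob_norm s (w t)) \<le> vsob_norm s (couple (w \<tau>) - couple (w t))"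
    unfolding eventually_at_filter by simp
  from Lim_null_comparison[OF this lim]
  show "((\<lambda>t. sob_norm s (w t)) \<longlongrightarrow> sob_norm s (w t)) (at t within I)"
    by (simp add: LIM_zero_iff)
qed

text \<open>Cauchy-Schwarz with the weight split equally between the factors, on finite sets of
  modes as required by the truncated energies.\<close>

lemma weighted_pairing_le:
  assumes "sob s u" "sob s v" "finite F"
  shows "(\<Sum>k\<in>F. jap (of_int k) powr (2 * s) * Re (cnj (u k) * v k)) \<le> sob_norm s u * sob_norm s v"
proof -
  let ?f = "\<lambda>u k. jap (of_int k) powr s * cmod (u k)"
  have "jap (of_int k) powr (2 * s) * Re (cnj (u k) * v k) \<le> \<bar>?f u k\<bar> * \<bar>?f v k\<bar>" for k :: int
  proof -
    have "jap (of_int k) powr (2 * s) * Re (cnj (u k) * v k) \<le> jap (of_int k) powr (2 * s) * (cmod (u k) * cmod (v k))"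
      using complex_Re_le_cmod[of "cnj (u k) * v k"] by (intro mult_left_mono) (auto simp: norm_mult)
    also have "\<dots> = \<bar>?f u k\<bar> * \<bar>?f v k\<bar>"
      by (simp add: abs_mult algebra_simps flip: powr_add mult_2)
    finally show ?thesis .
  qed
  then have "(\<Sum>k\<in>F. jap (of_int k) powr (2 * s) * Re (cnj (u k) * v k)) \<le> (\<Sum>k\<in>F. \<bar>?f u k\<bar> * \<bar>?f v k\<bar>)"
    by (intro sum_mono)
  also have "\<dots> \<le> L2_set (?f u) F * L2_set (?f v) F" by (rule L2_set_mult_ineq)
  also have "\<dots> \<le> sob_norm s u * sob_norm s v"
    using assms by (intro mult_mono L2_set_le_sob_norm sob_norm_nonneg L2_set_nonneg)
  finally show ?thesis .
qed

text \<open>The Sobolev weight depends only on the modulus of the mode, so a symmetric truncation is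
  a weighted sum over super action blocks.\<close>

lemma sum_modes_regroup:
  "(\<Sum>k\<in>{- int M..int M}. jap (of_int k) powr s * f k)
   = (\<Sum>n\<le>M. jap (real n) powr s * (\<Sum>k | nat \<bar>k\<bar> = n. f k))" for f :: "int \<Rightarrow> real"
proof -
  have "(\<Sum>k\<in>{- int M..int M}. jap (of_int k) powr s * f k)
      = (\<Sum>n\<le>M. \<Sum>k\<in>{k \<in> {- int M..int M}. nat \<bar>k\<bar> = n}. jap (of_int k) powr s * f k)"
    by (rule sum.group[symmetric]) auto
  also have "\<dots> = (\<Sum>n\<le>M. \<Sum>k | nat \<bar>k\<bar> = n. jap (real n) powr s * f k)"
    by (intro sum.cong) auto
  finally show ?thesis by (simp add: sum_distrib_left)
qed

text \<open>The solution is differentiable only in H^(s-m), so the H^s norm is not differentiated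
  directly. The energy of the modes up to M is a finite sum; it is differentiated and integrated
  with bounds independent of M.\<close>

lemma energy_estimate:
  assumes sol: "is_solution m s {0..<T} B Y (\<lambda>t. couple (w t))" and m: "m \<ge> 0"
    and rate: "\<And>n t. t \<in> {0..<T} \<Longrightarrow> (\<Sum>k | nat \<bar>k\<bar> = n. Re (cnj (w t k) * Y (couple (w t)) Pl k))
        = (\<Sum>k | nat \<bar>k\<bar> = n. Re (cnj (w t k) * R t k))"
    and R: "\<And>t. t \<in> {0..<T} \<Longrightarrow> sob s (R t)"
      "\<And>t. t \<in> {0..<T} \<Longrightarrow> sob_norm s (R t) \<le> C * sob_norm s (w t) ^ (p + 1)"
    and t: "t \<in> {0..<T}"
  shows "(sob_norm s (w t))\<^sup>2 \<le> (sob_norm s (w 0))\<^sup>2 + 2 * C * integral {0..t} (\<lambda>\<tau>. sob_norm s (w \<tau>) ^ (p + 2))"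
proof -
  define b where "b = (sob_norm s (w 0))\<^sup>2 + 2 * C * integral {0..t} (\<lambda>\<tau>. sob_norm s (w \<tau>) ^ (p + 2))"
  define E where "E M \<tau> = (\<Sum>k\<in>{- int M..int M}. jap (of_int k) powr (2 * s) * (cmod (w \<tau> k))\<^sup>2)" for M \<tau>
  define E' where "E' M \<tau> = (\<Sum>k\<in>{- int M..int M}. jap (of_int k) powr (2 * s) * (2 * Re (cnj (w \<tau> k) * Y (couple (w \<tau>)) Pl k)))" for M \<tau>
  have sob: "sob s (w \<tau>)" if "\<tau> \<in> {0..<T}" for \<tau>
    using solution_coefficients(1)[OF sol m that] .
  have sub: "{0..t} \<subseteq> {0..<T}" using t by auto
  have EM: "E M t \<le> b" for M
  proof -
    have "(E M has_vector_derivative E' M \<tau>) (at \<tau> within {0..t})" if "\<tau> \<in> {0..t}" for \<tau>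
    proof -
      have "((\<lambda>\<tau>. (cmod (w \<tau> k))\<^sup>2) has_real_derivative 2 * Re (cnj (w \<tau> k) * Y (couple (w \<tau>)) Pl k)) (at \<tau> within {0..t})" for k
      proof -
        have "((\<lambda>\<tau>. w \<tau> k) has_vector_derivative Y (couple (w \<tau>)) Pl k) (at \<tau> within {0..t})"
          using solution_coefficients(2)[OF sol m, of \<tau> k] that sub has_vector_derivative_within_subset by blast
        then have r: "((\<lambda>\<tau>. Re (w \<tau> k)) has_real_derivative Re (Y (couple (w \<tau>)) Pl k)) (at \<tau> within {0..t})"
          and i: "((\<lambda>\<tau>. Im (w \<tau> k)) has_real_derivative Im (Y (couple (w \<tau>)) Pl k)) (at \<tau> within {0..t})"
          unfolding has_vector_derivative_complex_iff by auto
        show ?thesis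
          using DERIV_add[OF DERIV_power[OF r, of 2] DERIV_power[OF i, of 2]]
          unfolding cmod_power2 by (simp add: algebra_simps)
      qed
      then show ?thesis
        unfolding E_def[abs_def] E'_def has_real_derivative_iff_has_vector_derivative[symmetric]
        by (intro DERIV_sum DERIV_cmult)
    qed
    then have I: "(E' M has_integral (E M t - E M 0)) {0..t}"
      using t by (intro fundamental_theorem_of_calculus) auto
    have "continuous_on {0..t} (\<lambda>\<tau>. 2 * C * sob_norm s (w \<tau>) ^ (p + 2))"
      using sol sub unfolding is_solution_def
      by (intro continuous_intros continuous_on_subset[OF continuous_on_solution_norm]) auto
    then have J: "((\<lambda>\<tau>. 2 * C * sob_norm s (w \<tau>) ^ (p + 2)) has_integral
        integral {0..t} (\<lambda>\<tau>. 2 * C * sob_norm s (w \<tau>) ^ (p + 2))) {0..t}"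
      by (intro integrable_integral integrable_continuous_interval)
    have "E' M \<tau> \<le> 2 * C * sob_norm s (w \<tau>) ^ (p + 2)" if "\<tau> \<in> {0..t}" for \<tau>
    proof -
      have \<tau>: "\<tau> \<in> {0..<T}" using that sub by blast
      \<comment> \<open>After regrouping, \<open>rate\<close> replaces the field by the remainder
        block by block.\<close>
      have "E' M \<tau> = 2 * (\<Sum>k\<in>{- int M..int M}. jap (of_int k) powr (2 * s) * Re (cnj (w \<tau> k) * R \<tau> k))"
        unfolding E'_def sum_modes_regroup sum_distrib_left[symmetric] rate[OF \<tau>]
        by (simp add: sum_distrib_left algebra_simps)
      also have "\<dots> \<le> 2 * (sob_norm s (w \<tau>) * sob_norm s (R \<tau>))"
        using weighted_pairing_le[OF sob[OF \<tau>] R(1)[OF \<tau>], of "{- int M..int M}"] by simp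
      also have "\<dots> \<le> 2 * (sob_norm s (w \<tau>) * (C * sob_norm s (w \<tau>) ^ (p + 1)))"
        using R(2)[OF \<tau>] sob_norm_nonneg[of s "w \<tau>"] by (intro mult_left_mono) auto
      finally show ?thesis by (simp add: algebra_simps)
    qed
    from has_integral_le[OF I J this]
    have "E M t \<le> E M 0 + 2 * C * integral {0..t} (\<lambda>\<tau>. sob_norm s (w \<tau>) ^ (p + 2))" by simp
    moreover have "E M 0 \<le> (sob_norm s (w 0))\<^sup>2"
      unfolding E_def sob_norm_square using sob[of 0] t
      by (intro finite_sum_le_infsum) (auto simp: sob_def)
    ultimately show ?thesis by (simp add: b_def)
  qed
  \<comment> \<open>Every finite set of modes lies in some window, so the uniform bound passes to
    the infinite sum.\<close>
  have "(\<Sum>k\<in>F. jap (of_int k) powr (2 * s) * (cmod (w t k))\<^sup>2) \<le> b" if F: "finite F" for F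
  proof -
    obtain M where M: "\<And>k. k \<in> F \<Longrightarrow> nat \<bar>k\<bar> \<le> M"
      using finite_imageI[OF F, of "\<lambda>k. nat \<bar>k\<bar>"] unfolding finite_nat_set_iff_bounded_le by auto
    have "F \<subseteq> {- int M..int M}"
    proof
      fix k assume "k \<in> F"
      from M[OF this] show "k \<in> {- int M..int M}" by auto
    qed
    then have "(\<Sum>k\<in>F. jap (of_int k) powr (2 * s) * (cmod (w t k))\<^sup>2) \<le> E M t"
      unfolding E_def by (intro sum_mono2) auto
    then show ?thesis using EM[of M] by linarith
  qed
  then have "(sob_norm s (w t))\<^sup>2 \<le> b"
    unfolding sob_norm_square using sob[OF t, unfolded sob_def] by (intro infsum_le_finite_sums)
  then show ?thesis by (simp only: b_def)
qed

theorem corollary3p8: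
  fixes k N :: nat and m m' \<rho> r s0 \<delta> :: real
    and f :: "real \<Rightarrow> real"
    and X :: cutoff_fun and Xs :: "nat \<Rightarrow> cutoff_fun"
    and \<mm> \<mm>1 \<mm>' :: ssym
    and Q :: "sign \<Rightarrow> sign \<Rightarrow> sop"
    and Y :: "vec \<Rightarrow> vec"
  assumes "m = real k / 2" and "m > 1" and "m' = m - 1 / 2" and "\<rho> \<ge> 0" and "N \<ge> 1"
    and "r > 0" and "\<delta> > 0"
    and "cutoff \<delta> 1 X" and "\<And>p. p \<ge> 1 \<Longrightarrow> cutoff \<delta> p (Xs p)"
    and "classical_symbol m (\<lambda>\<xi>. complex_of_real (f \<xi>))" and "\<And>\<xi>. f (- \<xi>) = f \<xi>"
    and "\<And>\<sigma> \<sigma>'. sum_smoothing m s0 r N \<rho> 2 (Q \<sigma> \<sigma>')" and "real_to_real s0 r N 2 Q"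
    and "sum_symbol m s0 r N m 2 \<mm>" and "x_independent s0 r N 2 \<mm>" and "real_valued s0 r N 2 \<mm>"
    and "sum_function m s0 r N 1 \<mm>1" and "x_independent s0 r N 1 \<mm>1" and "real_valued s0 r N 1 \<mm>1"
    and "sum_symbol m s0 r N m' 1 \<mm>'" and "x_independent s0 r N 1 \<mm>'"
    and "\<And>w x \<xi>. couple w \<in> sball s0 r \<Longrightarrow>
           sum_eval N 2 \<mm> (couple w) x \<xi> =
             sum_eval N 1 \<mm>1 (couple w) x \<xi> * of_real (f \<xi>) + sum_eval N 1 \<mm>' (couple w) x \<xi>"
    and "Y = nf_field X Xs N (\<lambda>j. f (of_int j)) \<mm> Q"
    and "hamiltonian_field s0 r Y"
  shows "\<exists>s1\<ge>s0. \<forall>s\<ge>s1. \<exists>r1 C. 0 < r1 \<and> r1 \<le> r \<and> 0 < C \<and>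
           (\<forall>T>0. \<forall>w :: real \<Rightarrow> fn.
              is_solution m s {0..<T} (sball s0 r1) Y (\<lambda>t. couple (w t)) \<and>
              couple (w 0) \<in> sball s r1 \<longrightarrow>
              (\<forall>t\<in>{0..<T}. (sob_norm s (w t))\<^sup>2 \<le>
                 (sob_norm s (w 0))\<^sup>2 + C * integral {0..t} (\<lambda>\<tau>. sob_norm s (w \<tau>) ^ (N + 2))))"
\<comment> \<open>The threshold s0 itself serves as s1, because the smoothing estimate is available
  for every s at least s0.\<close>
proof (rule exI[of _ s0], intro conjI allI impI)
  fix s assume s: "s0 \<le> s"
  have R: "nonhom_smoothing m s0 r \<rho> N (snd (Q Pl \<sigma>'))" for \<sigma>'
    using assms(12) by (simp add: sum_smoothing_def)
  obtain r1 C1 where r1: "0 < r1" "0 < C1" and C1: "\<And>u \<sigma>. couple u \<in> sball s0 r1 \<Longrightarrow> sob s u \<Longrightarrow>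
      sob s (snd (Q Pl Pl) (couple u) (couple u \<sigma>)) \<and>
      sob_norm s (snd (Q Pl Pl) (couple u) (couple u \<sigma>)) \<le> C1 * sob_norm s0 u ^ N * sob_norm s u"
    using nonhom_smoothing_bound[OF R \<open>N \<ge> 1\<close> \<open>\<rho> \<ge> 0\<close> s] by metis
  obtain r2 C2 where r2: "0 < r2" "0 < C2" and C2: "\<And>u \<sigma>. couple u \<in> sball s0 r2 \<Longrightarrow> sob s u \<Longrightarrow>
      sob s (snd (Q Pl Mi) (couple u) (couple u \<sigma>)) \<and>
      sob_norm s (snd (Q Pl Mi) (couple u) (couple u \<sigma>)) \<le> C2 * sob_norm s0 u ^ N * sob_norm s u"
    using nonhom_smoothing_bound[OF R \<open>N \<ge> 1\<close> \<open>\<rho> \<ge> 0\<close> s] by metis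
  \<comment> \<open>The solution has to stay in the domain of the Hamiltonian field and in the balls
    where both remainder entries are estimated.\<close>
  define r' where "r' = min r (min r1 r2)"
  have R_bound: "sob s (nonhom_smooth_part Q u) \<and>
      sob_norm s (nonhom_smooth_part Q u) \<le> (C1 + C2) * sob_norm s u ^ (N + 1)"
    if u: "couple u \<in> sball s0 r'" "sob s u" for u
  proof -
    let ?R1 = "snd (Q Pl Pl) (couple u) (couple u Pl)" and ?R2 = "snd (Q Pl Mi) (couple u) (couple u Mi)"
    have u': "couple u \<in> sball s0 r1" "couple u \<in> sball s0 r2" using u by (auto simp: r'_def couple_in_sball)
    have S: "sob s ?R1" "sob s ?R2" using C1[OF u'(1) u(2)] C2[OF u'(2) u(2)] by blast+
    have "sob_norm s (?R1 + ?R2) \<le> sob_norm s ?R1 + sob_norm s ?R2" by (rule sob_norm_triangle[OF S])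
    also have "\<dots> \<le> C1 * sob_norm s0 u ^ N * sob_norm s u + C2 * sob_norm s0 u ^ N * sob_norm s u"
      using C1[OF u'(1) u(2)] C2[OF u'(2) u(2)] by (intro add_mono) blast+
    also have "\<dots> = (C1 + C2) * (sob_norm s0 u ^ N * sob_norm s u)"
      by (simp add: algebra_simps)
    \<comment> \<open>The low norm is dominated by the H^s norm, which yields the power N +
      1.\<close>
    also have "\<dots> \<le> (C1 + C2) * (sob_norm s u ^ N * sob_norm s u)"
      using r1 r2 sob_norm_mono[OF u(2) s] sob_norm_nonneg by (intro mult_left_mono mult_right_mono power_mono) auto
    finally show ?thesis
      using sob_add[OF S] unfolding nonhom_smooth_part_eq by (simp add: mult.commute del: plus_fun_apply)
  qed
  have "(sob_norm s (w t))\<^sup>2 \<le> (sob_norm s (w 0))\<^sup>2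
      + 2 * (C1 + C2) * integral {0..t} (\<lambda>\<tau>. sob_norm s (w \<tau>) ^ (N + 2))"
    if sol: "is_solution m s {0..<T} (sball s0 r') Y (\<lambda>t. couple (w t))" and t: "t \<in> {0..<T}" for T w t
  proof (rule energy_estimate[where R = "\<lambda>t. nonhom_smooth_part Q (w t)", OF sol _ _ _ _ t])
    show "0 \<le> m" using assms(2) by simp
    fix \<tau> assume \<tau>: "\<tau> \<in> {0..<T}"
    have w: "couple (w \<tau>) \<in> sball s0 r'" using sol \<tau> by (simp add: is_solution_def)
    then have "couple (w \<tau>) \<in> sball s0 r" by (auto simp: r'_def couple_in_sball)
    then show "(\<Sum>k | nat \<bar>k\<bar> = n. Re (cnj (w \<tau> k) * Y (couple (w \<tau>)) Pl k))
        = (\<Sum>k | nat \<bar>k\<bar> = n. Re (cnj (w \<tau> k) * nonhom_smooth_part Q (w \<tau>) k))" for n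
      using assms(24) unfolding assms(23)
      by (intro super_action_rate[OF \<open>N \<ge> 1\<close> \<open>\<rho> \<ge> 0\<close> assms(12,14,15,16)])
    have "sob s (w \<tau>)" using solution_coefficients(1)[OF sol _ \<tau>] assms(2) by simp
    from R_bound[OF w this] show "sob s (nonhom_smooth_part Q (w \<tau>))"
      "sob_norm s (nonhom_smooth_part Q (w \<tau>)) \<le> (C1 + C2) * sob_norm s (w \<tau>) ^ (N + 1)" by blast+
  qed
  then show "\<exists>r1 C. 0 < r1 \<and> r1 \<le> r \<and> 0 < C \<and>
           (\<forall>T>0. \<forall>w :: real \<Rightarrow> fn.
              is_solution m s {0..<T} (sball s0 r1) Y (\<lambda>t. couple (w t)) \<and>
              couple (w 0) \<in> sball s r1 \<longrightarrow>
              (\<forall>t\<in>{0..<T}. (sob_norm s (w t))\<^sup>2 \<le>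
                 (sob_norm s (w 0))\<^sup>2 + C * integral {0..t} (\<lambda>\<tau>. sob_norm s (w \<tau>) ^ (N + 2))))"
    \<comment> \<open>The factor 2 comes from differentiating the squared moduli.\<close>
    using r1 r2 \<open>r > 0\<close> by (intro exI[of _ r'] exI[of _ "2 * (C1 + C2)"]) (auto simp: r'_def)
qed simp

end
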